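(* Let $p$ be a prime number and let $G$ and $H$ be finite $p$-groups such that $FG\cong FH$ as $F$-algebras for some field $F$ of characteristic $p$. Then there exists a finite field $F_0$ of characteristic $p$ such that $F_0G\cong F_0H$ as $F_0$-algebras.
   Context: For a field $K$ and a group $G$, $KG$ denotes the group algebra of $G$ over $K$. Isomorphisms between group algebras over $K$ are isomorphisms of $K$-algebras. The field $F_0$ is not required to be contained in $F$. *)

theory Defs
  imports "HOL-Computational_Algebra.Primes" "HOL-Algebra.Algebra"
begin

definition finite_p_group :: "nat \<Rightarrow> ('a, 'n) monoid_scheme \<Rightarrow> bool" where
  "finite_p_group p G \<longleftrightarrow>
     group G \<and> finite (carrier G) \<and> (\<exists>k. order G = p ^ k)"

definition ring_characteristic :: "('k, 'm) ring_scheme \<Rightarrow> nat" where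
  "ring_characteristic R =
     (if \<exists>n::nat. 0 < n \<and> [n] \<cdot>\<^bsub>R\<^esub> \<one>\<^bsub>R\<^esub> = \<zero>\<^bsub>R\<^esub>
      then LEAST n::nat. 0 < n \<and> [n] \<cdot>\<^bsub>R\<^esub> \<one>\<^bsub>R\<^esub> = \<zero>\<^bsub>R\<^esub>
      else 0)"

text \<open>
  A formal sum of group elements is represented by its coefficient function: a finitely
  supported function on the carrier of the group, \<^const>\<open>undefined\<close> outside of it.
  The product is convolution; summing over the support of the left factor keeps
  the sum finite for infinite groups as well.
\<close>

definition group_algebra ::
  "('k, 'm) ring_scheme \<Rightarrow> ('a, 'n) monoid_scheme \<Rightarrow> ('k, 'a \<Rightarrow> 'k) module" where
  "group_algebra K G =
     \<lparr> carrier = {f \<in> carrier G \<rightarrow>\<^sub>E carrier K. finite {g \<in> carrier G. f g \<noteq> \<zero>\<^bsub>K\<^esub>}},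
       monoid.mult = (\<lambda>f f'. \<lambda>x\<in>carrier G.
         \<Oplus>\<^bsub>K\<^esub>y\<in>{y \<in> carrier G. f y \<noteq> \<zero>\<^bsub>K\<^esub>}. f y \<otimes>\<^bsub>K\<^esub> f' (inv\<^bsub>G\<^esub> y \<otimes>\<^bsub>G\<^esub> x)),
       monoid.one = (\<lambda>x\<in>carrier G. if x = \<one>\<^bsub>G\<^esub> then \<one>\<^bsub>K\<^esub> else \<zero>\<^bsub>K\<^esub>),
       ring.zero = (\<lambda>x\<in>carrier G. \<zero>\<^bsub>K\<^esub>),
       ring.add = (\<lambda>f f'. \<lambda>x\<in>carrier G. f x \<oplus>\<^bsub>K\<^esub> f' x),
       module.smult = (\<lambda>c f. \<lambda>x\<in>carrier G. c \<otimes>\<^bsub>K\<^esub> f x) \<rparr>"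

text \<open>
  The library locale \<^locale>\<open>algebra\<close> only covers commutative algebras, so isomorphisms of
  (possibly noncommutative) algebras are taken as linear ring isomorphisms.
\<close>

definition algebra_iso ::
  "('k, 'm) ring_scheme \<Rightarrow> ('k, 'a, 'n) module_scheme \<Rightarrow> ('k, 'b, 'l) module_scheme
     \<Rightarrow> ('a \<Rightarrow> 'b) set" where
  "algebra_iso K A B =
     {h \<in> ring_iso A B. \<forall>c\<in>carrier K. \<forall>x\<in>carrier A. h (c \<odot>\<^bsub>A\<^esub> x) = c \<odot>\<^bsub>B\<^esub> h x}"

definition algebra_isomorphic ::
  "('k, 'm) ring_scheme \<Rightarrow> ('k, 'a, 'n) module_scheme \<Rightarrow> ('k, 'b, 'l) module_scheme \<Rightarrow> bool" where
  "algebra_isomorphic K A B \<longleftrightarrow> algebra_iso K A B \<noteq> {}"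

end

theory Submission
  imports Defs
begin

text \<open>
  An isomorphism of the group algebras and its inverse are given by two matrices over \<open>F\<close>
  satisfying polynomial equations with coefficients \<open>0\<close> and \<open>1\<close>, so it suffices to map
  a subring of \<open>F\<close> containing all matrix entries homomorphically to a finite field. This is
  Zariski's lemma in disguise: homomorphisms into the algebraic closure of the prime field are
  extended along one generator at a time, with the stronger induction hypothesis that any given
  nonzero element can be kept nonzero. The algebraic closure of the prime field is realised as
  the set of elements \<open>c\<close> with \<open>c ^ (p ^ m) = c\<close> for some \<open>m > 0\<close> in an algebraic closure
  of \<open>F\<close>; finitely many such elements lie in a common finite subfield.
\<close>

section \<open>Isomorphisms of group algebras as matrices\<close>

text \<open>Invertibility is not an equation in the matrix of an isomorphism alone; with the inverse
  matrix carried along it becomes one, so that a ring homomorphism transports it. The obstacle to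
  extending homomorphisms is a vanishing element: a homomorphism that kills \<open>u\<close> cannot
  be extended to a ring containing the inverse of \<open>u\<close>. In general the danger lies in
  leading coefficients of polynomials that describe the new generator. Being able to keep one
  prescribed element nonzero, and hence a product of several, removes it; the price is that this
  ability has to be re-established for the larger ring. The extension step needs roots of
  nonconstant polynomials in the target, so the target cannot be finite from the start. An algebraic
  closure of \<open>F\<close> would be too large, since it may contain elements transcendental over
  the prime field; the periodic elements still have all the roots, and finitely many of them share a
  period. Finiteness is therefore recovered only at the end, from the images of the finitely many
  matrix entries.\<close>

lemma (in abelian_monoid) finsum_swap:
  assumes "finite I" "finite J" "\<And>i j. i \<in> I \<Longrightarrow> j \<in> J \<Longrightarrow> f i j \<in> carrier G"
  shows "(\<Oplus>i\<in>I. \<Oplus>j\<in>J. f i j) = (\<Oplus>j\<in>J. \<Oplus>i\<in>I. f i j)"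
  using assms(1,3)
proof (induction I rule: finite_induct)
  case (insert i I)
  have "(\<Oplus>k\<in>insert i I. \<Oplus>j\<in>J. f k j) = (\<Oplus>j\<in>J. f i j) \<oplus> (\<Oplus>j\<in>J. \<Oplus>k\<in>I. f k j)"
    using insert by (subst finsum_insert) auto
  also have "\<dots> = (\<Oplus>j\<in>J. f i j \<oplus> (\<Oplus>k\<in>I. f k j))"
    using insert.prems by (intro finsum_addf[symmetric]) auto
  also have "\<dots> = (\<Oplus>j\<in>J. \<Oplus>k\<in>insert i I. f k j)"
  proof (rule finsum_cong')
    fix j
    assume "j \<in> J"
    then show "f i j \<oplus> (\<Oplus>k\<in>I. f k j) = (\<Oplus>k\<in>insert i I. f k j)"
      using insert by (subst finsum_insert) auto
  qed (use insert in auto)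
  finally show ?case .
qed simp

section \<open>Coordinates with respect to the basis of group elements\<close>

definition group_basis :: "('k, 'm) ring_scheme \<Rightarrow> ('a, 'n) monoid_scheme \<Rightarrow> 'a \<Rightarrow> 'a \<Rightarrow> 'k" where
  "group_basis K G g = (\<lambda>x\<in>carrier G. if x = g then \<one>\<^bsub>K\<^esub> else \<zero>\<^bsub>K\<^esub>)"

lemma group_basis_apply:
  "x \<in> carrier G \<Longrightarrow> group_basis K G g x = (if x = g then \<one>\<^bsub>K\<^esub> else \<zero>\<^bsub>K\<^esub>)"
  by (simp add: group_basis_def)

locale finite_group_algebra = K: field K + G: group G
  for K :: "('k, 'm) ring_scheme" and G :: "('a, 'n) monoid_scheme" +
  assumes finite_carrier: "finite (carrier G)"
begin

abbreviation "KG \<equiv> group_algebra K G"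

lemma carrier_iff: "f \<in> carrier KG \<longleftrightarrow> f \<in> carrier G \<rightarrow>\<^sub>E carrier K"
  using finite_carrier by (simp add: group_algebra_def)

lemma carrier_apply [simp]: "f \<in> carrier KG \<Longrightarrow> x \<in> carrier G \<Longrightarrow> f x \<in> carrier K"
  by (auto simp: carrier_iff)

lemma add_apply: "x \<in> carrier G \<Longrightarrow> (f \<oplus>\<^bsub>KG\<^esub> f') x = f x \<oplus>\<^bsub>K\<^esub> f' x"
  by (simp add: group_algebra_def)

lemma smult_apply: "x \<in> carrier G \<Longrightarrow> (c \<odot>\<^bsub>KG\<^esub> f) x = c \<otimes>\<^bsub>K\<^esub> f x"
  by (simp add: group_algebra_def)

lemma one_eq: "\<one>\<^bsub>KG\<^esub> = group_basis K G \<one>\<^bsub>G\<^esub>"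
  by (simp add: group_algebra_def group_basis_def)

lemma mult_apply:
  assumes "f \<in> carrier KG" "f' \<in> carrier KG" "x \<in> carrier G"
  shows "(f \<otimes>\<^bsub>KG\<^esub> f') x = (\<Oplus>\<^bsub>K\<^esub>y\<in>carrier G. f y \<otimes>\<^bsub>K\<^esub> f' (inv\<^bsub>G\<^esub> y \<otimes>\<^bsub>G\<^esub> x))"
proof -
  have "(f \<otimes>\<^bsub>KG\<^esub> f') x =
      (\<Oplus>\<^bsub>K\<^esub>y\<in>{y \<in> carrier G. f y \<noteq> \<zero>\<^bsub>K\<^esub>}. f y \<otimes>\<^bsub>K\<^esub> f' (inv\<^bsub>G\<^esub> y \<otimes>\<^bsub>G\<^esub> x))"
    using assms(3) by (simp add: group_algebra_def)
  also have "\<dots> = (\<Oplus>\<^bsub>K\<^esub>y\<in>carrier G. f y \<otimes>\<^bsub>K\<^esub> f' (inv\<^bsub>G\<^esub> y \<otimes>\<^bsub>G\<^esub> x))"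
    using assms finite_carrier by (intro K.add.finprod_mono_neutral_cong_left) auto
  finally show ?thesis .
qed

lemma eqI:
  assumes "f \<in> carrier KG" "f' \<in> carrier KG" "\<And>x. x \<in> carrier G \<Longrightarrow> f x = f' x"
  shows "f = f'"
  using assms unfolding carrier_iff by (metis PiE_ext)

lemma basis_closed [simp]: "group_basis K G g \<in> carrier KG"
  by (auto simp: carrier_iff group_basis_def)

lemma one_closed: "\<one>\<^bsub>KG\<^esub> \<in> carrier KG"
  by (simp add: one_eq)

lemma add_closed: "f \<in> carrier KG \<Longrightarrow> f' \<in> carrier KG \<Longrightarrow> f \<oplus>\<^bsub>KG\<^esub> f' \<in> carrier KG"
  by (subst carrier_iff) (auto simp: group_algebra_def)

lemma smult_closed: "c \<in> carrier K \<Longrightarrow> f \<in> carrier KG \<Longrightarrow> c \<odot>\<^bsub>KG\<^esub> f \<in> carrier KG"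
  by (subst carrier_iff) (auto simp: group_algebra_def)

lemma mult_closed: "f \<in> carrier KG \<Longrightarrow> f' \<in> carrier KG \<Longrightarrow> f \<otimes>\<^bsub>KG\<^esub> f' \<in> carrier KG"
  by (subst carrier_iff) (auto simp: group_algebra_def intro!: K.finsum_closed)

lemma basis_mult:
  assumes "g \<in> carrier G" "g' \<in> carrier G"
  shows "group_basis K G g \<otimes>\<^bsub>KG\<^esub> group_basis K G g' = group_basis K G (g \<otimes>\<^bsub>G\<^esub> g')"
proof (rule eqI)
  fix x
  assume x: "x \<in> carrier G"
  have "(group_basis K G g \<otimes>\<^bsub>KG\<^esub> group_basis K G g') x =
      (\<Oplus>\<^bsub>K\<^esub>y\<in>carrier G. if g = y then group_basis K G g' (inv\<^bsub>G\<^esub> y \<otimes>\<^bsub>G\<^esub> x) else \<zero>\<^bsub>K\<^esub>)"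
    unfolding mult_apply[OF basis_closed basis_closed x]
    using x by (intro K.finsum_cong') (auto simp: group_basis_apply)
  also have "\<dots> = group_basis K G g' (inv\<^bsub>G\<^esub> g \<otimes>\<^bsub>G\<^esub> x)"
    using assms x finite_carrier by (intro K.finsum_singleton) auto
  also have "\<dots> = group_basis K G (g \<otimes>\<^bsub>G\<^esub> g') x"
    using assms x by (auto simp: group_basis_apply G.inv_solve_left' simp del: G.m_assoc)
  finally show "(group_basis K G g \<otimes>\<^bsub>KG\<^esub> group_basis K G g') x = group_basis K G (g \<otimes>\<^bsub>G\<^esub> g') x" .
qed (simp_all add: mult_closed)

text \<open>One basis vector at a time is split off from a set containing the support of
  \<open>f\<close>. \<open>\<Lambda>\<close> is scalar valued so that the lemma applies to every
  coordinate \<open>\<lambda>f. h f y\<close> of a linear map \<open>h\<close>; all large sums are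
  then formed in \<open>K\<close>, never in a group algebra.\<close>

lemma linear_expansion:
  assumes closed: "\<And>f. f \<in> carrier KG \<Longrightarrow> \<Lambda> f \<in> carrier K"
    and add: "\<And>f f'. f \<in> carrier KG \<Longrightarrow> f' \<in> carrier KG \<Longrightarrow> \<Lambda> (f \<oplus>\<^bsub>KG\<^esub> f') = \<Lambda> f \<oplus>\<^bsub>K\<^esub> \<Lambda> f'"
    and smult: "\<And>c f. c \<in> carrier K \<Longrightarrow> f \<in> carrier KG \<Longrightarrow> \<Lambda> (c \<odot>\<^bsub>KG\<^esub> f) = c \<otimes>\<^bsub>K\<^esub> \<Lambda> f"
    and f: "f \<in> carrier KG"
  shows "\<Lambda> f = (\<Oplus>\<^bsub>K\<^esub>g\<in>carrier G. f g \<otimes>\<^bsub>K\<^esub> \<Lambda> (group_basis K G g))"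
proof -
  have "\<Lambda> f = (\<Oplus>\<^bsub>K\<^esub>g\<in>T. f g \<otimes>\<^bsub>K\<^esub> \<Lambda> (group_basis K G g))"
    if "finite T" "T \<subseteq> carrier G" "f \<in> carrier KG" "\<And>x. x \<in> carrier G - T \<Longrightarrow> f x = \<zero>\<^bsub>K\<^esub>" for T f
    using that
  proof (induction T arbitrary: f rule: finite_induct)
    case empty
    \<comment> \<open>Here \<open>f\<close> vanishes on the whole group, so it equals its own
      multiple by zero, and homogeneity of \<open>\<Lambda>\<close> gives the value zero.\<close>
    have "f = \<zero>\<^bsub>K\<^esub> \<odot>\<^bsub>KG\<^esub> f"
      using empty by (intro eqI) (auto simp: smult_apply smult_closed)
    then have "\<Lambda> f = \<zero>\<^bsub>K\<^esub> \<otimes>\<^bsub>K\<^esub> \<Lambda> f"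
      using smult[of "\<zero>\<^bsub>K\<^esub>" f] empty by simp
    then show ?case
      using closed empty by simp
  next
    case (insert t T)
    have t: "t \<in> carrier G"
      using insert.prems by simp
    define f' where "f' = (\<lambda>x\<in>carrier G. if x = t then \<zero>\<^bsub>K\<^esub> else f x)"
    have f'_apply: "f' x = (if x = t then \<zero>\<^bsub>K\<^esub> else f x)" if "x \<in> carrier G" for x
      using that by (simp add: f'_def)
    have f': "f' \<in> carrier KG"
      using insert.prems by (auto simp: carrier_iff f'_def)
    have "f = f t \<odot>\<^bsub>KG\<^esub> group_basis K G t \<oplus>\<^bsub>KG\<^esub> f'"
      using insert.prems t f'
      by (intro eqI) (auto simp: smult_closed add_closed add_apply smult_apply group_basis_apply f'_apply)
    then have "\<Lambda> f = f t \<otimes>\<^bsub>K\<^esub> \<Lambda> (group_basis K G t) \<oplus>\<^bsub>K\<^esub> \<Lambda> f'"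
      using add[of "f t \<odot>\<^bsub>KG\<^esub> group_basis K G t" f'] smult[of "f t" "group_basis K G t"]
        insert.prems t f' by (simp add: smult_closed)
    also have "\<Lambda> f' = (\<Oplus>\<^bsub>K\<^esub>g\<in>T. f' g \<otimes>\<^bsub>K\<^esub> \<Lambda> (group_basis K G g))"
      using insert f' by (intro insert.IH) (auto simp: f'_apply)
    also have "\<dots> = (\<Oplus>\<^bsub>K\<^esub>g\<in>T. f g \<otimes>\<^bsub>K\<^esub> \<Lambda> (group_basis K G g))"
    proof (rule K.finsum_cong')
      fix g assume "g \<in> T"
      then show "f' g \<otimes>\<^bsub>K\<^esub> \<Lambda> (group_basis K G g) = f g \<otimes>\<^bsub>K\<^esub> \<Lambda> (group_basis K G g)"
        using insert.hyps insert.prems f'_apply[of g] by auto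
    qed (use insert.prems closed in auto)
    also have "f t \<otimes>\<^bsub>K\<^esub> \<Lambda> (group_basis K G t) \<oplus>\<^bsub>K\<^esub> \<dots> =
        (\<Oplus>\<^bsub>K\<^esub>g\<in>insert t T. f g \<otimes>\<^bsub>K\<^esub> \<Lambda> (group_basis K G g))"
      using insert.hyps insert.prems closed t by (subst K.finsum_insert) auto
    finally show ?case .
  qed
  then show ?thesis
    using f finite_carrier by blast
qed

end

text \<open>Row \<open>A g\<close> holds the coordinates of the image of the group element
  \<open>g\<close>, row \<open>B y\<close> those of the preimage of \<open>y\<close>. Apart from
  membership of the entries, every clause is a polynomial equation with coefficients 0 and 1. Both
  matrix products are prescribed, which makes \<open>B\<close> a two-sided inverse without comparing
  the orders of \<open>G\<close> and \<open>H\<close>.\<close>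

definition group_algebra_matrices ::
    "('k, 'm) ring_scheme \<Rightarrow> ('a, 'n) monoid_scheme \<Rightarrow> ('b, 'l) monoid_scheme \<Rightarrow>
     ('a \<Rightarrow> 'b \<Rightarrow> 'k) \<Rightarrow> ('b \<Rightarrow> 'a \<Rightarrow> 'k) \<Rightarrow> bool" where
  "group_algebra_matrices K G H A B \<longleftrightarrow>
     (\<forall>g\<in>carrier G. \<forall>y\<in>carrier H. A g y \<in> carrier K) \<and>
     (\<forall>y\<in>carrier H. \<forall>g\<in>carrier G. B y g \<in> carrier K) \<and>
     (\<forall>y\<in>carrier H. A \<one>\<^bsub>G\<^esub> y = (if y = \<one>\<^bsub>H\<^esub> then \<one>\<^bsub>K\<^esub> else \<zero>\<^bsub>K\<^esub>)) \<and>
     (\<forall>g\<in>carrier G. \<forall>g'\<in>carrier G. \<forall>y\<in>carrier H.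
        A (g \<otimes>\<^bsub>G\<^esub> g') y = (\<Oplus>\<^bsub>K\<^esub>z\<in>carrier H. A g z \<otimes>\<^bsub>K\<^esub> A g' (inv\<^bsub>H\<^esub> z \<otimes>\<^bsub>H\<^esub> y))) \<and>
     (\<forall>g\<in>carrier G. \<forall>x\<in>carrier G.
        (\<Oplus>\<^bsub>K\<^esub>y\<in>carrier H. A g y \<otimes>\<^bsub>K\<^esub> B y x) = (if x = g then \<one>\<^bsub>K\<^esub> else \<zero>\<^bsub>K\<^esub>)) \<and>
     (\<forall>y\<in>carrier H. \<forall>z\<in>carrier H.
        (\<Oplus>\<^bsub>K\<^esub>g\<in>carrier G. B y g \<otimes>\<^bsub>K\<^esub> A g z) = (if z = y then \<one>\<^bsub>K\<^esub> else \<zero>\<^bsub>K\<^esub>))"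

locale group_algebra_pair = G: finite_group_algebra K G + H: finite_group_algebra K H
  for K :: "('k, 'm) ring_scheme" and G :: "('a, 'n) monoid_scheme" and H :: "('b, 'l) monoid_scheme"
begin

abbreviation "KG \<equiv> group_algebra K G"
abbreviation "KH \<equiv> group_algebra K H"

lemma matrices_of_iso:
  assumes h: "h \<in> algebra_iso K KG KH"
  shows "\<exists>A B. group_algebra_matrices K G H A B"
proof -
  define k where "k = inv_into (carrier KG) h"
  have bij: "bij_betw h (carrier KG) (carrier KH)"
    and hh: "h \<in> ring_hom KG KH"
    and h_smult: "\<And>c f. c \<in> carrier K \<Longrightarrow> f \<in> carrier KG \<Longrightarrow> h (c \<odot>\<^bsub>KG\<^esub> f) = c \<odot>\<^bsub>KH\<^esub> h f"
    using h by (auto simp: algebra_iso_def ring_iso_def)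
  note h_closed = ring_hom_closed[OF hh] and h_add = ring_hom_add[OF hh]
    and h_mult = ring_hom_mult[OF hh] and h_one = ring_hom_one[OF hh]
  have k_closed: "k u \<in> carrier KG" and hk: "h (k u) = u" if "u \<in> carrier KH" for u
    using that bij bij_betw_imp_surj_on[OF bij] unfolding k_def
    by (auto simp: inv_into_into f_inv_into_f)
  have kh: "k (h f) = f" if "f \<in> carrier KG" for f
    using that bij unfolding k_def by (simp add: bij_betw_def)
  \<comment> \<open>Linearity is pulled back through \<open>h\<close>: \<open>kh\<close> is applied
    to the right-hand side, whose image under \<open>h\<close> is the argument of \<open>k\<close>
    on the left.\<close>
  have k_add: "k (u \<oplus>\<^bsub>KH\<^esub> v) = k u \<oplus>\<^bsub>KG\<^esub> k v" if "u \<in> carrier KH" "v \<in> carrier KH" for u v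
    using kh[of "k u \<oplus>\<^bsub>KG\<^esub> k v"] that by (simp add: k_closed hk h_add G.add_closed)
  have k_smult: "k (c \<odot>\<^bsub>KH\<^esub> u) = c \<odot>\<^bsub>KG\<^esub> k u" if "c \<in> carrier K" "u \<in> carrier KH" for c u
    using kh[of "c \<odot>\<^bsub>KG\<^esub> k u"] that by (simp add: k_closed hk h_smult G.smult_closed)
  define A where "A g = h (group_basis K G g)" for g
  define B where "B y = k (group_basis K H y)" for y
  have h_expand: "h f y = (\<Oplus>\<^bsub>K\<^esub>g\<in>carrier G. f g \<otimes>\<^bsub>K\<^esub> A g y)"
    if "f \<in> carrier KG" "y \<in> carrier H" for f y
    unfolding A_def using that
    by (intro G.linear_expansion[where \<Lambda> = "\<lambda>f. h f y"])
      (auto simp: h_closed h_add h_smult H.add_apply H.smult_apply)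
  have k_expand: "k u x = (\<Oplus>\<^bsub>K\<^esub>y\<in>carrier H. u y \<otimes>\<^bsub>K\<^esub> B y x)"
    if "u \<in> carrier KH" "x \<in> carrier G" for u x
    unfolding B_def using that
    by (intro H.linear_expansion[where \<Lambda> = "\<lambda>f. k f x"])
      (auto simp: k_closed k_add k_smult G.add_apply G.smult_apply)
  have "group_algebra_matrices K G H A B"
    unfolding group_algebra_matrices_def
  proof (intro conjI ballI)
    fix g y assume "g \<in> carrier G" "y \<in> carrier H"
    then show "A g y \<in> carrier K"
      by (simp add: A_def h_closed)
  next
    fix y g assume "y \<in> carrier H" "g \<in> carrier G"
    then show "B y g \<in> carrier K"
      by (simp add: B_def k_closed)
  next
    fix y assume "y \<in> carrier H"
    then show "A \<one>\<^bsub>G\<^esub> y = (if y = \<one>\<^bsub>H\<^esub> then \<one>\<^bsub>K\<^esub> else \<zero>\<^bsub>K\<^esub>)"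
      using h_one by (simp add: A_def G.one_eq H.one_eq group_basis_apply)
  next
    fix g g' y assume "g \<in> carrier G" "g' \<in> carrier G" "y \<in> carrier H"
    then show "A (g \<otimes>\<^bsub>G\<^esub> g') y = (\<Oplus>\<^bsub>K\<^esub>z\<in>carrier H. A g z \<otimes>\<^bsub>K\<^esub> A g' (inv\<^bsub>H\<^esub> z \<otimes>\<^bsub>H\<^esub> y))"
      by (simp add: A_def G.basis_mult[symmetric] h_mult H.mult_apply h_closed)
  next
    fix g x assume "g \<in> carrier G" "x \<in> carrier G"
    then show "(\<Oplus>\<^bsub>K\<^esub>y\<in>carrier H. A g y \<otimes>\<^bsub>K\<^esub> B y x) = (if x = g then \<one>\<^bsub>K\<^esub> else \<zero>\<^bsub>K\<^esub>)"
      using k_expand[of "A g" x] by (simp add: A_def h_closed kh group_basis_apply)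
  next
    fix y z assume "y \<in> carrier H" "z \<in> carrier H"
    then show "(\<Oplus>\<^bsub>K\<^esub>g\<in>carrier G. B y g \<otimes>\<^bsub>K\<^esub> A g z) = (if z = y then \<one>\<^bsub>K\<^esub> else \<zero>\<^bsub>K\<^esub>)"
      using h_expand[of "B y" z] by (simp add: B_def k_closed hk group_basis_apply)
  qed
  then show ?thesis
    by blast
qed

text \<open>Associativity of the product of the row vector \<open>f\<close> with the matrices
  \<open>A\<close> and \<open>B\<close>, followed by the relation that \<open>A\<close> times
  \<open>B\<close> is the identity. Only this one of the two product relations is assumed, so that
  the lemma with \<open>G\<close> and \<open>H\<close> exchanged settles the other
  composition.\<close>

lemma linear_comp_delta:
  assumes A: "\<And>g y. g \<in> carrier G \<Longrightarrow> y \<in> carrier H \<Longrightarrow> A g y \<in> carrier K"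
    and B: "\<And>g y. g \<in> carrier G \<Longrightarrow> y \<in> carrier H \<Longrightarrow> B y g \<in> carrier K"
    and AB: "\<And>g x. g \<in> carrier G \<Longrightarrow> x \<in> carrier G \<Longrightarrow>
      (\<Oplus>\<^bsub>K\<^esub>y\<in>carrier H. A g y \<otimes>\<^bsub>K\<^esub> B y x) = (if x = g then \<one>\<^bsub>K\<^esub> else \<zero>\<^bsub>K\<^esub>)"
    and f: "f \<in> carrier KG" and x: "x \<in> carrier G"
  shows "(\<Oplus>\<^bsub>K\<^esub>y\<in>carrier H. (\<Oplus>\<^bsub>K\<^esub>g\<in>carrier G. f g \<otimes>\<^bsub>K\<^esub> A g y) \<otimes>\<^bsub>K\<^esub> B y x) = f x"
proof -
  note fin = G.finite_carrier H.finite_carrier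
  have "(\<Oplus>\<^bsub>K\<^esub>y\<in>carrier H. (\<Oplus>\<^bsub>K\<^esub>g\<in>carrier G. f g \<otimes>\<^bsub>K\<^esub> A g y) \<otimes>\<^bsub>K\<^esub> B y x) =
      (\<Oplus>\<^bsub>K\<^esub>y\<in>carrier H. \<Oplus>\<^bsub>K\<^esub>g\<in>carrier G. f g \<otimes>\<^bsub>K\<^esub> (A g y \<otimes>\<^bsub>K\<^esub> B y x))"
  proof (rule G.K.finsum_cong')
    fix y assume y: "y \<in> carrier H"
    have "(\<Oplus>\<^bsub>K\<^esub>g\<in>carrier G. f g \<otimes>\<^bsub>K\<^esub> A g y) \<otimes>\<^bsub>K\<^esub> B y x =
        (\<Oplus>\<^bsub>K\<^esub>g\<in>carrier G. f g \<otimes>\<^bsub>K\<^esub> A g y \<otimes>\<^bsub>K\<^esub> B y x)"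
      using f x A B fin y by (intro G.K.finsum_ldistr) auto
    also have "\<dots> = (\<Oplus>\<^bsub>K\<^esub>g\<in>carrier G. f g \<otimes>\<^bsub>K\<^esub> (A g y \<otimes>\<^bsub>K\<^esub> B y x))"
      using f x A B y by (intro G.K.finsum_cong') (auto simp: G.K.m_assoc)
    finally show "(\<Oplus>\<^bsub>K\<^esub>g\<in>carrier G. f g \<otimes>\<^bsub>K\<^esub> A g y) \<otimes>\<^bsub>K\<^esub> B y x =
        (\<Oplus>\<^bsub>K\<^esub>g\<in>carrier G. f g \<otimes>\<^bsub>K\<^esub> (A g y \<otimes>\<^bsub>K\<^esub> B y x))" .
  qed (use f x A B in auto)
  also have "\<dots> = (\<Oplus>\<^bsub>K\<^esub>g\<in>carrier G. \<Oplus>\<^bsub>K\<^esub>y\<in>carrier H. f g \<otimes>\<^bsub>K\<^esub> (A g y \<otimes>\<^bsub>K\<^esub> B y x))"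
    using f x A B fin by (intro G.K.finsum_swap) auto
  also have "\<dots> = (\<Oplus>\<^bsub>K\<^esub>g\<in>carrier G. if x = g then f g else \<zero>\<^bsub>K\<^esub>)"
  proof (rule G.K.finsum_cong')
    fix g assume g: "g \<in> carrier G"
    have "(\<Oplus>\<^bsub>K\<^esub>y\<in>carrier H. f g \<otimes>\<^bsub>K\<^esub> (A g y \<otimes>\<^bsub>K\<^esub> B y x)) =
        f g \<otimes>\<^bsub>K\<^esub> (\<Oplus>\<^bsub>K\<^esub>y\<in>carrier H. A g y \<otimes>\<^bsub>K\<^esub> B y x)"
      using f x A B fin g by (intro G.K.finsum_rdistr[symmetric]) auto
    then show "(\<Oplus>\<^bsub>K\<^esub>y\<in>carrier H. f g \<otimes>\<^bsub>K\<^esub> (A g y \<otimes>\<^bsub>K\<^esub> B y x)) = (if x = g then f g else \<zero>\<^bsub>K\<^esub>)"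
      using f x g by (simp add: AB)
  qed (use f in auto)
  also have "\<dots> = f x"
    using f x fin by (intro G.K.finsum_singleton) auto
  finally show ?thesis .
qed

end

lemma group_algebra_pair_swap:
  "group_algebra_pair K G H \<Longrightarrow> group_algebra_pair K H G"
  by (simp add: group_algebra_pair_def)

context group_algebra_pair
begin

lemma iso_of_matrices:
  assumes "group_algebra_matrices K G H A B"
  shows "algebra_isomorphic K KG KH"
proof -
  have A: "A g y \<in> carrier K" and B: "B y g \<in> carrier K"
    if "g \<in> carrier G" "y \<in> carrier H" for g y
    using assms that by (auto simp: group_algebra_matrices_def)
  have A_one: "A \<one>\<^bsub>G\<^esub> y = (if y = \<one>\<^bsub>H\<^esub> then \<one>\<^bsub>K\<^esub> else \<zero>\<^bsub>K\<^esub>)" if "y \<in> carrier H" for y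
    using assms that by (auto simp: group_algebra_matrices_def)
  have A_mult: "A (g \<otimes>\<^bsub>G\<^esub> g') y = (\<Oplus>\<^bsub>K\<^esub>z\<in>carrier H. A g z \<otimes>\<^bsub>K\<^esub> A g' (inv\<^bsub>H\<^esub> z \<otimes>\<^bsub>H\<^esub> y))"
    if "g \<in> carrier G" "g' \<in> carrier G" "y \<in> carrier H" for g g' y
    using assms that by (auto simp: group_algebra_matrices_def)
  have AB: "(\<Oplus>\<^bsub>K\<^esub>y\<in>carrier H. A g y \<otimes>\<^bsub>K\<^esub> B y x) = (if x = g then \<one>\<^bsub>K\<^esub> else \<zero>\<^bsub>K\<^esub>)"
    if "g \<in> carrier G" "x \<in> carrier G" for g x
    using assms that by (auto simp: group_algebra_matrices_def)
  have BA: "(\<Oplus>\<^bsub>K\<^esub>g\<in>carrier G. B y g \<otimes>\<^bsub>K\<^esub> A g z) = (if z = y then \<one>\<^bsub>K\<^esub> else \<zero>\<^bsub>K\<^esub>)"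
    if "y \<in> carrier H" "z \<in> carrier H" for y z
    using assms that by (auto simp: group_algebra_matrices_def)
  note fin = G.finite_carrier H.finite_carrier
  interpret swap: group_algebra_pair K H G
    by (rule group_algebra_pair_swap) unfold_locales
  define h where "h f = (\<lambda>y\<in>carrier H. \<Oplus>\<^bsub>K\<^esub>g\<in>carrier G. f g \<otimes>\<^bsub>K\<^esub> A g y)" for f
  define k where "k u = (\<lambda>x\<in>carrier G. \<Oplus>\<^bsub>K\<^esub>y\<in>carrier H. u y \<otimes>\<^bsub>K\<^esub> B y x)" for u
  have h_apply: "h f y = (\<Oplus>\<^bsub>K\<^esub>g\<in>carrier G. f g \<otimes>\<^bsub>K\<^esub> A g y)" if "y \<in> carrier H" for f y
    using that by (simp add: h_def)
  have k_apply: "k u x = (\<Oplus>\<^bsub>K\<^esub>y\<in>carrier H. u y \<otimes>\<^bsub>K\<^esub> B y x)" if "x \<in> carrier G" for u x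
    using that by (simp add: k_def)
  have h_closed: "h f \<in> carrier KH" if "f \<in> carrier KG" for f
    using that A by (auto simp: H.carrier_iff h_def intro!: G.K.finsum_closed)
  have k_closed: "k u \<in> carrier KG" if "u \<in> carrier KH" for u
    using that B by (auto simp: G.carrier_iff k_def intro!: G.K.finsum_closed)
  have kh: "k (h f) = f" if f: "f \<in> carrier KG" for f
  proof (rule G.eqI)
    fix x assume x: "x \<in> carrier G"
    have "k (h f) x = (\<Oplus>\<^bsub>K\<^esub>y\<in>carrier H. (\<Oplus>\<^bsub>K\<^esub>g\<in>carrier G. f g \<otimes>\<^bsub>K\<^esub> A g y) \<otimes>\<^bsub>K\<^esub> B y x)"
      unfolding k_apply[OF x] using f x A B by (intro G.K.finsum_cong') (auto simp: h_apply)
    also have "\<dots> = f x"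
      using A B AB f x by (rule linear_comp_delta)
    finally show "k (h f) x = f x" .
  qed (use f h_closed k_closed in auto)
  have hk: "h (k u) = u" if u: "u \<in> carrier KH" for u
  proof (rule H.eqI)
    fix y assume y: "y \<in> carrier H"
    have "h (k u) y = (\<Oplus>\<^bsub>K\<^esub>g\<in>carrier G. (\<Oplus>\<^bsub>K\<^esub>z\<in>carrier H. u z \<otimes>\<^bsub>K\<^esub> B z g) \<otimes>\<^bsub>K\<^esub> A g y)"
      unfolding h_apply[OF y] using u y A B by (intro G.K.finsum_cong') (auto simp: k_apply)
    also have "\<dots> = u y"
      using B A BA u y by (rule swap.linear_comp_delta)
    finally show "h (k u) y = u y" .
  qed (use u h_closed k_closed in auto)
  have bij: "bij_betw h (carrier KG) (carrier KH)"
    using h_closed k_closed hk kh by (intro bij_betwI[where g = k]) auto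
  \<comment> \<open>Both sides are brought to the sum of \<open>?t z w v\<close> over
    \<open>z\<close>, \<open>w\<close> in \<open>G\<close> and \<open>v\<close> in \<open>H\<close>.
    On the left, the convolution is reindexed by \<open>x = z w\<close>, since left multiplication
    by \<open>z\<close> permutes \<open>G\<close>, and \<open>A_mult\<close> expands the row of
    \<open>z w\<close>. On the right, the two coefficients of \<open>h f\<close> and
    \<open>h f'\<close> are multiplied out.\<close>
  have h_mult: "h (f \<otimes>\<^bsub>KG\<^esub> f') = h f \<otimes>\<^bsub>KH\<^esub> h f'" if f: "f \<in> carrier KG" "f' \<in> carrier KG" for f f'
  proof (rule H.eqI)
    fix y assume y: "y \<in> carrier H"
    let ?t = "\<lambda>z w v. (f z \<otimes>\<^bsub>K\<^esub> f' w) \<otimes>\<^bsub>K\<^esub> (A z v \<otimes>\<^bsub>K\<^esub> A w (inv\<^bsub>H\<^esub> v \<otimes>\<^bsub>H\<^esub> y))"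
    have t: "?t z w v \<in> carrier K" if "z \<in> carrier G" "w \<in> carrier G" "v \<in> carrier H" for z w v
      using that f y A by simp
    have "h (f \<otimes>\<^bsub>KG\<^esub> f') y =
        (\<Oplus>\<^bsub>K\<^esub>x\<in>carrier G. \<Oplus>\<^bsub>K\<^esub>z\<in>carrier G. f z \<otimes>\<^bsub>K\<^esub> f' (inv\<^bsub>G\<^esub> z \<otimes>\<^bsub>G\<^esub> x) \<otimes>\<^bsub>K\<^esub> A x y)"
      unfolding h_apply[OF y] using f y A fin
      by (intro G.K.finsum_cong') (auto simp: G.mult_apply G.K.finsum_ldistr Pi_def)
    also have "\<dots> = (\<Oplus>\<^bsub>K\<^esub>z\<in>carrier G. \<Oplus>\<^bsub>K\<^esub>x\<in>carrier G. f z \<otimes>\<^bsub>K\<^esub> f' (inv\<^bsub>G\<^esub> z \<otimes>\<^bsub>G\<^esub> x) \<otimes>\<^bsub>K\<^esub> A x y)"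
      using f y A fin by (intro G.K.finsum_swap) auto
    also have "\<dots> = (\<Oplus>\<^bsub>K\<^esub>z\<in>carrier G. \<Oplus>\<^bsub>K\<^esub>w\<in>carrier G. f z \<otimes>\<^bsub>K\<^esub> f' w \<otimes>\<^bsub>K\<^esub> A (z \<otimes>\<^bsub>G\<^esub> w) y)"
    proof (rule G.K.finsum_cong')
      fix z assume z: "z \<in> carrier G"
      have surj: "(\<lambda>w. z \<otimes>\<^bsub>G\<^esub> w) ` carrier G = carrier G"
        using z by (rule G.G.surj_const_mult)
      have inj: "inj_on (\<lambda>w. z \<otimes>\<^bsub>G\<^esub> w) (carrier G)"
        using z by (rule G.G.inj_on_cmult)
      have "(\<Oplus>\<^bsub>K\<^esub>x\<in>carrier G. f z \<otimes>\<^bsub>K\<^esub> f' (inv\<^bsub>G\<^esub> z \<otimes>\<^bsub>G\<^esub> x) \<otimes>\<^bsub>K\<^esub> A x y) =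
          (\<Oplus>\<^bsub>K\<^esub>w\<in>carrier G. f z \<otimes>\<^bsub>K\<^esub> f' (inv\<^bsub>G\<^esub> z \<otimes>\<^bsub>G\<^esub> (z \<otimes>\<^bsub>G\<^esub> w)) \<otimes>\<^bsub>K\<^esub> A (z \<otimes>\<^bsub>G\<^esub> w) y)"
        using f y A z inj
        by (subst surj[symmetric], intro G.K.finsum_reindex) (auto simp: surj)
      also have "\<dots> = (\<Oplus>\<^bsub>K\<^esub>w\<in>carrier G. f z \<otimes>\<^bsub>K\<^esub> f' w \<otimes>\<^bsub>K\<^esub> A (z \<otimes>\<^bsub>G\<^esub> w) y)"
        using f y A z by (intro G.K.finsum_cong') (auto simp: G.G.m_assoc[symmetric])
      finally show "(\<Oplus>\<^bsub>K\<^esub>x\<in>carrier G. f z \<otimes>\<^bsub>K\<^esub> f' (inv\<^bsub>G\<^esub> z \<otimes>\<^bsub>G\<^esub> x) \<otimes>\<^bsub>K\<^esub> A x y) =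
          (\<Oplus>\<^bsub>K\<^esub>w\<in>carrier G. f z \<otimes>\<^bsub>K\<^esub> f' w \<otimes>\<^bsub>K\<^esub> A (z \<otimes>\<^bsub>G\<^esub> w) y)" .
    qed (use f y A in auto)
    also have "\<dots> = (\<Oplus>\<^bsub>K\<^esub>z\<in>carrier G. \<Oplus>\<^bsub>K\<^esub>w\<in>carrier G. \<Oplus>\<^bsub>K\<^esub>v\<in>carrier H. ?t z w v)"
    proof (intro G.K.finsum_cong')
      fix z w assume zw: "z \<in> carrier G" "w \<in> carrier G"
      show "f z \<otimes>\<^bsub>K\<^esub> f' w \<otimes>\<^bsub>K\<^esub> A (z \<otimes>\<^bsub>G\<^esub> w) y = (\<Oplus>\<^bsub>K\<^esub>v\<in>carrier H. ?t z w v)"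
        unfolding A_mult[OF zw y] using f y A fin zw by (intro G.K.finsum_rdistr) auto
    qed (use t in auto)
    also have "\<dots> = (\<Oplus>\<^bsub>K\<^esub>z\<in>carrier G. \<Oplus>\<^bsub>K\<^esub>v\<in>carrier H. \<Oplus>\<^bsub>K\<^esub>w\<in>carrier G. ?t z w v)"
      using t fin by (intro G.K.finsum_cong' G.K.finsum_swap) auto
    also have "\<dots> = (\<Oplus>\<^bsub>K\<^esub>v\<in>carrier H. \<Oplus>\<^bsub>K\<^esub>z\<in>carrier G. \<Oplus>\<^bsub>K\<^esub>w\<in>carrier G. ?t z w v)"
      using t fin by (intro G.K.finsum_swap) auto
    also have "\<dots> = (\<Oplus>\<^bsub>K\<^esub>v\<in>carrier H. h f v \<otimes>\<^bsub>K\<^esub> h f' (inv\<^bsub>H\<^esub> v \<otimes>\<^bsub>H\<^esub> y))"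
    proof (rule G.K.finsum_cong')
      fix v assume v: "v \<in> carrier H"
      let ?b = "h f' (inv\<^bsub>H\<^esub> v \<otimes>\<^bsub>H\<^esub> y)"
      have vy: "inv\<^bsub>H\<^esub> v \<otimes>\<^bsub>H\<^esub> y \<in> carrier H"
        using v y by simp
      have b: "?b = (\<Oplus>\<^bsub>K\<^esub>w\<in>carrier G. f' w \<otimes>\<^bsub>K\<^esub> A w (inv\<^bsub>H\<^esub> v \<otimes>\<^bsub>H\<^esub> y))" "?b \<in> carrier K"
        using H.carrier_apply[OF h_closed[OF f(2)] vy] h_apply[OF vy] by simp_all
      have "h f v \<otimes>\<^bsub>K\<^esub> ?b = (\<Oplus>\<^bsub>K\<^esub>z\<in>carrier G. (f z \<otimes>\<^bsub>K\<^esub> A z v) \<otimes>\<^bsub>K\<^esub> ?b)"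
        unfolding h_apply[OF v] using f v A fin b by (intro G.K.finsum_ldistr) auto
      also have "\<dots> = (\<Oplus>\<^bsub>K\<^esub>z\<in>carrier G. \<Oplus>\<^bsub>K\<^esub>w\<in>carrier G. ?t z w v)"
      proof (rule G.K.finsum_cong')
        fix z assume z: "z \<in> carrier G"
        have "(f z \<otimes>\<^bsub>K\<^esub> A z v) \<otimes>\<^bsub>K\<^esub> ?b =
            (\<Oplus>\<^bsub>K\<^esub>w\<in>carrier G. (f z \<otimes>\<^bsub>K\<^esub> A z v) \<otimes>\<^bsub>K\<^esub> (f' w \<otimes>\<^bsub>K\<^esub> A w (inv\<^bsub>H\<^esub> v \<otimes>\<^bsub>H\<^esub> y)))"
          unfolding b(1) using f v A fin y z by (intro G.K.finsum_rdistr) auto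
        also have "\<dots> = (\<Oplus>\<^bsub>K\<^esub>w\<in>carrier G. ?t z w v)"
          using f v A y z by (intro G.K.finsum_cong') (auto simp: G.K.m_ac)
        finally show "(f z \<otimes>\<^bsub>K\<^esub> A z v) \<otimes>\<^bsub>K\<^esub> ?b = (\<Oplus>\<^bsub>K\<^esub>w\<in>carrier G. ?t z w v)" .
      qed (use t v in auto)
      finally show "(\<Oplus>\<^bsub>K\<^esub>z\<in>carrier G. \<Oplus>\<^bsub>K\<^esub>w\<in>carrier G. ?t z w v) = h f v \<otimes>\<^bsub>K\<^esub> ?b" ..
    qed (use f h_closed y in auto)
    also have "\<dots> = (h f \<otimes>\<^bsub>KH\<^esub> h f') y"
      using H.mult_apply[OF h_closed[OF f(1)] h_closed[OF f(2)] y] ..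
    finally show "h (f \<otimes>\<^bsub>KG\<^esub> f') y = (h f \<otimes>\<^bsub>KH\<^esub> h f') y" .
  qed (use f h_closed G.mult_closed H.mult_closed in auto)
  have h_add: "h (f \<oplus>\<^bsub>KG\<^esub> f') = h f \<oplus>\<^bsub>KH\<^esub> h f'" if f: "f \<in> carrier KG" "f' \<in> carrier KG" for f f'
  proof (rule H.eqI)
    fix y assume y: "y \<in> carrier H"
    have "h (f \<oplus>\<^bsub>KG\<^esub> f') y = (\<Oplus>\<^bsub>K\<^esub>g\<in>carrier G. f g \<otimes>\<^bsub>K\<^esub> A g y \<oplus>\<^bsub>K\<^esub> f' g \<otimes>\<^bsub>K\<^esub> A g y)"
      unfolding h_apply[OF y] using f y A
      by (intro G.K.finsum_cong') (auto simp: G.add_apply G.K.l_distr)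
    also have "\<dots> = (h f \<oplus>\<^bsub>KH\<^esub> h f') y"
      using f y A by (simp add: H.add_apply h_apply G.K.finsum_addf)
    finally show "h (f \<oplus>\<^bsub>KG\<^esub> f') y = (h f \<oplus>\<^bsub>KH\<^esub> h f') y" .
  qed (use f h_closed G.add_closed H.add_closed in auto)
  have h_smult: "h (c \<odot>\<^bsub>KG\<^esub> f) = c \<odot>\<^bsub>KH\<^esub> h f" if f: "c \<in> carrier K" "f \<in> carrier KG" for c f
  proof (rule H.eqI)
    fix y assume y: "y \<in> carrier H"
    have "h (c \<odot>\<^bsub>KG\<^esub> f) y = (\<Oplus>\<^bsub>K\<^esub>g\<in>carrier G. c \<otimes>\<^bsub>K\<^esub> (f g \<otimes>\<^bsub>K\<^esub> A g y))"
      unfolding h_apply[OF y] using f y A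
      by (intro G.K.finsum_cong') (auto simp: G.smult_apply G.K.m_assoc)
    also have "\<dots> = c \<otimes>\<^bsub>K\<^esub> (\<Oplus>\<^bsub>K\<^esub>g\<in>carrier G. f g \<otimes>\<^bsub>K\<^esub> A g y)"
      using f y A fin by (intro G.K.finsum_rdistr[symmetric]) auto
    also have "\<dots> = (c \<odot>\<^bsub>KH\<^esub> h f) y"
      using y by (simp add: H.smult_apply h_apply)
    finally show "h (c \<odot>\<^bsub>KG\<^esub> f) y = (c \<odot>\<^bsub>KH\<^esub> h f) y" .
  qed (use f h_closed G.smult_closed H.smult_closed in auto)
  have h_one: "h \<one>\<^bsub>KG\<^esub> = \<one>\<^bsub>KH\<^esub>"
  proof (rule H.eqI)
    fix y assume y: "y \<in> carrier H"
    have "h \<one>\<^bsub>KG\<^esub> y = (\<Oplus>\<^bsub>K\<^esub>g\<in>carrier G. if \<one>\<^bsub>G\<^esub> = g then A g y else \<zero>\<^bsub>K\<^esub>)"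
      unfolding h_apply[OF y] using y A
      by (intro G.K.finsum_cong') (auto simp: G.one_eq group_basis_apply)
    also have "\<dots> = A \<one>\<^bsub>G\<^esub> y"
      using y A fin by (intro G.K.finsum_singleton) auto
    also have "\<dots> = \<one>\<^bsub>KH\<^esub> y"
      using y by (simp add: A_one H.one_eq group_basis_apply)
    finally show "h \<one>\<^bsub>KG\<^esub> y = \<one>\<^bsub>KH\<^esub> y" .
  qed (use h_closed G.one_closed H.one_closed in auto)
  have "h \<in> algebra_iso K KG KH"
    using h_closed h_mult h_add h_one h_smult bij
    by (auto simp: algebra_iso_def ring_iso_def intro!: ring_hom_memI)
  then show ?thesis
    by (auto simp: algebra_isomorphic_def)
qed

end

section \<open>Transport of the matrix equations along a ring homomorphism\<close>

lemma ring_hom_subring_finsum: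
  assumes F: "ring F" and E: "ring E" and T: "subring T F"
    and \<phi>: "\<phi> \<in> ring_hom (F\<lparr>carrier := T\<rparr>) E" and f: "\<And>i. i \<in> I \<Longrightarrow> f i \<in> T"
  shows "\<phi> (\<Oplus>\<^bsub>F\<^esub>i\<in>I. f i) = (\<Oplus>\<^bsub>E\<^esub>i\<in>I. \<phi> (f i))" "(\<Oplus>\<^bsub>F\<^esub>i\<in>I. f i) \<in> T"
proof -
  interpret F: ring F by fact
  interpret \<phi>: ring_hom_ring "F\<lparr>carrier := T\<rparr>" E \<phi>
    using F.subring_is_ring[OF T] E \<phi> by (rule ring_hom_ringI2)
  note T = subringE[OF T]
  \<comment> \<open>Membership is carried through the induction because additivity of
    \<open>\<phi>\<close> is available only on \<open>T\<close>, whereas the sums are formed in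
    \<open>F\<close>. Over an infinite index set both sums are zero by convention.\<close>
  have "\<phi> (\<Oplus>\<^bsub>F\<^esub>i\<in>I. f i) = (\<Oplus>\<^bsub>E\<^esub>i\<in>I. \<phi> (f i)) \<and> (\<Oplus>\<^bsub>F\<^esub>i\<in>I. f i) \<in> T"
    using f
  proof (induction I rule: infinite_finite_induct)
    case (insert i I)
    have "(\<Oplus>\<^bsub>F\<^esub>j\<in>insert i I. f j) = f i \<oplus>\<^bsub>F\<^esub> (\<Oplus>\<^bsub>F\<^esub>j\<in>I. f j)"
      using insert T(1) by (intro F.finsum_insert) auto
    moreover have "(\<Oplus>\<^bsub>E\<^esub>j\<in>insert i I. \<phi> (f j)) = \<phi> (f i) \<oplus>\<^bsub>E\<^esub> (\<Oplus>\<^bsub>E\<^esub>j\<in>I. \<phi> (f j))"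
      using insert \<phi>.hom_closed by (intro \<phi>.S.finsum_insert) auto
    ultimately show ?case
      using insert T(7) \<phi>.hom_add[of "f i" "\<Oplus>\<^bsub>F\<^esub>j\<in>I. f j"] by simp
  qed (use T(2) \<phi>.hom_zero in auto)
  then show "\<phi> (\<Oplus>\<^bsub>F\<^esub>i\<in>I. f i) = (\<Oplus>\<^bsub>E\<^esub>i\<in>I. \<phi> (f i))" "(\<Oplus>\<^bsub>F\<^esub>i\<in>I. f i) \<in> T"
    by auto
qed

lemma group_algebra_matrices_hom:
  assumes AB: "group_algebra_matrices F G H A B"
    and F: "ring F" and E: "ring E" and G: "group G" and H: "group H" and T: "subring T F"
    and \<phi>: "\<phi> \<in> ring_hom (F\<lparr>carrier := T\<rparr>) E"
    and A_T: "\<And>g y. g \<in> carrier G \<Longrightarrow> y \<in> carrier H \<Longrightarrow> A g y \<in> T"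
    and B_T: "\<And>g y. g \<in> carrier G \<Longrightarrow> y \<in> carrier H \<Longrightarrow> B y g \<in> T"
  shows "group_algebra_matrices E G H (\<lambda>g y. \<phi> (A g y)) (\<lambda>y g. \<phi> (B y g))"
proof -
  interpret F: ring F by fact
  interpret G: group G by fact
  interpret H: group H by fact
  interpret \<phi>: ring_hom_ring "F\<lparr>carrier := T\<rparr>" E \<phi>
    using F.subring_is_ring[OF T] E \<phi> by (rule ring_hom_ringI2)
  note sum = ring_hom_subring_finsum(1)[OF F E T \<phi>]
  have \<phi>_mult: "\<phi> (a \<otimes>\<^bsub>F\<^esub> b) = \<phi> a \<otimes>\<^bsub>E\<^esub> \<phi> b" if "a \<in> T" "b \<in> T" for a b
    using \<phi>.hom_mult[of a b] that by simp
  have \<phi>_sum: "\<phi> (\<Oplus>\<^bsub>F\<^esub>i\<in>I. a i \<otimes>\<^bsub>F\<^esub> b i) = (\<Oplus>\<^bsub>E\<^esub>i\<in>I. \<phi> (a i) \<otimes>\<^bsub>E\<^esub> \<phi> (b i))"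
    if "\<And>i. i \<in> I \<Longrightarrow> a i \<in> T" "\<And>i. i \<in> I \<Longrightarrow> b i \<in> T" for a b and I :: "'z set"
  proof -
    have "\<phi> (\<Oplus>\<^bsub>F\<^esub>i\<in>I. a i \<otimes>\<^bsub>F\<^esub> b i) = (\<Oplus>\<^bsub>E\<^esub>i\<in>I. \<phi> (a i \<otimes>\<^bsub>F\<^esub> b i))"
      using that subringE(6)[OF T] by (intro sum) auto
    also have "\<dots> = (\<Oplus>\<^bsub>E\<^esub>i\<in>I. \<phi> (a i) \<otimes>\<^bsub>E\<^esub> \<phi> (b i))"
      using that \<phi>.hom_closed by (intro \<phi>.S.finsum_cong') (auto simp: \<phi>_mult)
    finally show ?thesis .
  qed
  have \<phi>01: "\<phi> \<one>\<^bsub>F\<^esub> = \<one>\<^bsub>E\<^esub>" "\<phi> \<zero>\<^bsub>F\<^esub> = \<zero>\<^bsub>E\<^esub>"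
    using \<phi>.hom_one \<phi>.hom_zero by simp_all
  show ?thesis
    using AB A_T B_T \<phi>.hom_closed unfolding group_algebra_matrices_def
    by (auto simp: \<phi>_sum[symmetric] \<phi>01)
qed

section \<open>Frobenius\<close>

lemma (in cring) binomial:
  assumes x: "x \<in> carrier R" and y: "y \<in> carrier R"
  shows "(x \<oplus> y) [^] n = (\<Oplus>k\<in>{..n}. [(n choose k)] \<cdot> (x [^] k \<otimes> y [^] (n - k)))"
proof (induction n)
  case 0
  show ?case using x y by (simp add: Pi_def)
next
  case (Suc n)
  define T where "T m k = [(m choose k)] \<cdot> (x [^] k \<otimes> y [^] (m - k))" for m k :: nat
  have T: "T m k \<in> carrier R" for m k
    using x y by (simp add: T_def)
  \<comment> \<open>Pascal's rule. The index \<open>k = n\<close> is separate: there the second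
    summand has binomial coefficient zero, while the truncated difference \<open>n - Suc k\<close>
    no longer satisfies the identity used below.\<close>
  have Suc_T: "T (Suc n) (Suc k) = T n k \<otimes> x \<oplus> T n (Suc k) \<otimes> y" if "k \<le> n" for k
  proof (cases "k = n")
    case True
    then show ?thesis
      using x y by (simp add: T_def binomial_eq_0)
  next
    case False
    then have "n - k = Suc (n - Suc k)"
      using that by simp
    then show ?thesis
      using x y by (simp add: T_def add.nat_pow_mult[symmetric] add_pow_ldistr add_pow_rdistr m_ac)
  qed
  have T0: "T (Suc n) 0 = T n 0 \<otimes> y"
    using x y by (simp add: T_def)
  have "(\<Oplus>k\<in>{..Suc n}. T (Suc n) k) = (\<Oplus>k\<in>{..n}. T (Suc n) (Suc k)) \<oplus> T n 0 \<otimes> y"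
    using T by (subst finsum_Suc2) (auto simp: T0)
  also have "(\<Oplus>k\<in>{..n}. T (Suc n) (Suc k)) = (\<Oplus>k\<in>{..n}. T n k \<otimes> x \<oplus> T n (Suc k) \<otimes> y)"
    using T x y by (intro finsum_cong') (auto simp: Suc_T)
  also have "\<dots> \<oplus> T n 0 \<otimes> y =
      (\<Oplus>k\<in>{..n}. T n k) \<otimes> x \<oplus> ((\<Oplus>k\<in>{..n}. T n (Suc k)) \<oplus> T n 0) \<otimes> y"
    using T x y by (simp add: finsum_addf finsum_ldistr Pi_def l_distr a_assoc)
  also have "(\<Oplus>k\<in>{..n}. T n (Suc k)) \<oplus> T n 0 = (\<Oplus>k\<in>{..Suc n}. T n k)"
    using T by (subst finsum_Suc2) auto
  \<comment> \<open>The additional index \<open>Suc n\<close> contributes nothing, as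
    \<open>n choose Suc n\<close> is zero.\<close>
  also have "\<dots> = (\<Oplus>k\<in>{..n}. T n k)"
    using T x y by (subst finsum_Suc) (auto simp: T_def binomial_eq_0)
  also have "(\<Oplus>k\<in>{..n}. T n k) \<otimes> x \<oplus> (\<Oplus>k\<in>{..n}. T n k) \<otimes> y = (x \<oplus> y) [^] Suc n"
    using T x y Suc by (simp add: r_distr T_def[symmetric])
  finally show ?case
    by (simp add: T_def)
qed

lemma (in cring) add_pow_eq_zero:
  assumes "[p] \<cdot> \<one> = \<zero>" "p dvd n" "a \<in> carrier R"
  shows "[(n::nat)] \<cdot> a = \<zero>"
proof -
  obtain k where n: "n = p * k"
    using assms(2) by (rule dvdE)
  have "[p] \<cdot> a = \<zero>"
    using add_pow_ldistr[of \<one> a p] assms by simp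
  then show ?thesis
    using assms(3) by (simp add: n add.nat_pow_pow[symmetric])
qed

text \<open>The prime divides all inner binomial coefficients. Characteristic \<open>p\<close>
  enters in the form \<open>[p] \<cdot> \<one> = \<zero>\<close>, which passes along ring
  homomorphisms.\<close>

lemma (in cring) frobenius_add:
  assumes p: "Factorial_Ring.prime (p::nat)" "[p] \<cdot> \<one> = \<zero>"
    and x: "x \<in> carrier R" and y: "y \<in> carrier R"
  shows "(x \<oplus> y) [^] p = x [^] p \<oplus> y [^] p"
proof -
  obtain m where m: "p = Suc m"
    using p(1) prime_gt_0_nat by (metis not0_implies_Suc less_irrefl)
  define T where "T k = [(p choose k)] \<cdot> (x [^] k \<otimes> y [^] (p - k))" for k :: nat
  have T: "T k \<in> carrier R" for k
    using x y by (simp add: T_def)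
  have "T k = \<zero>" if "0 < k" "k < p" for k
    unfolding T_def
    using that p(1) x y by (intro add_pow_eq_zero[OF p(2)] dvd_choose_prime m_closed nat_pow_closed) simp_all
  moreover have T_ends: "T 0 = y [^] p" "T p = x [^] p"
    using x y by (simp_all add: T_def)
  ultimately have sum: "(\<Oplus>k\<in>{..p}. T k) = (\<Oplus>k\<in>{0, p}. T k)"
    using T by (intro add.finprod_mono_neutral_cong_right) auto
  have "p \<noteq> 0" using m by simp
  then have "(\<Oplus>k\<in>{0, p}. T k) = T 0 \<oplus> T p"
    using T by simp
  with sum have "(\<Oplus>k\<in>{..p}. T k) = x [^] p \<oplus> y [^] p"
    using T_ends x y by (simp add: a_comm)
  then show ?thesis
    using binomial[OF x y, of p] by (simp add: T_def)
qed

lemma (in cring) frobenius_pow_add: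
  assumes p: "Factorial_Ring.prime (p::nat)" "[p] \<cdot> \<one> = \<zero>"
    and x: "x \<in> carrier R" and y: "y \<in> carrier R"
  shows "(x \<oplus> y) [^] (p ^ m) = x [^] (p ^ m) \<oplus> y [^] (p ^ m)"
proof (induction m)
  case (Suc m)
  have "(x \<oplus> y) [^] (p ^ Suc m) = ((x \<oplus> y) [^] (p ^ m)) [^] p"
    using x y by (simp add: nat_pow_pow mult.commute)
  then show ?case
    using x y Suc by (simp add: frobenius_add[OF p] nat_pow_pow mult.commute)
qed (use x y in simp)

lemma (in cring) frobenius_pow_zero:
  assumes "Factorial_Ring.prime (p::nat)"
  shows "\<zero> [^] (p ^ m) = \<zero>"
  using assms prime_gt_0_nat by (simp add: nat_pow_zero)

lemma (in cring) frobenius_pow_minus: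
  assumes p: "Factorial_Ring.prime (p::nat)" "[p] \<cdot> \<one> = \<zero>" and x: "x \<in> carrier R"
  shows "(\<ominus> x) [^] (p ^ m) = \<ominus> (x [^] (p ^ m))"
proof -
  have "(\<ominus> x) [^] (p ^ m) \<oplus> x [^] (p ^ m) = \<zero>"
    using frobenius_pow_add[OF p, of "\<ominus> x" x m] frobenius_pow_zero[OF p(1)] x by (simp add: l_neg)
  then show ?thesis
    using x by (simp add: minus_equality)
qed

text \<open>For \<open>q = p ^ m\<close> with \<open>m > 0\<close>, in a field of characteristic
  \<open>p\<close>, these are the roots of X^q - X: the prime field when \<open>m = 1\<close>, and
  the subfield with \<open>q\<close> elements when the ambient field is algebraically
  closed.\<close>

definition frobenius_fixed :: "('f, 'l) ring_scheme \<Rightarrow> nat \<Rightarrow> 'f set" where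
  "frobenius_fixed F q = {x \<in> carrier F. x [^]\<^bsub>F\<^esub> q = x}"

lemma (in cring) subring_frobenius_fixed:
  assumes p: "Factorial_Ring.prime (p::nat)" "[p] \<cdot> \<one> = \<zero>"
  shows "subring (frobenius_fixed R (p ^ m)) R"
  by (rule subringI)
    (auto simp: frobenius_fixed_def frobenius_pow_add[OF p] frobenius_pow_minus[OF p] nat_pow_distrib)

text \<open>With \<open>n = m * k\<close>, raising to the power \<open>p ^ n\<close> is the
  \<open>k\<close>-fold iterate of raising to the power \<open>p ^ m\<close>; this is why
  divisibility replaces the order of the exponents.\<close>

lemma (in cring) frobenius_fixed_mono:
  assumes "m dvd n"
  shows "frobenius_fixed R (p ^ m) \<subseteq> frobenius_fixed R (p ^ n)"
proof -
  obtain k where n: "n = m * k"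
    using assms by (rule dvdE)
  have "x [^] (p ^ (m * k)) = x" if "x \<in> frobenius_fixed R (p ^ m)" for x
  proof (induction k)
    case (Suc k)
    have "x [^] (p ^ (m * Suc k)) = (x [^] (p ^ (m * k))) [^] (p ^ m)"
      using that by (simp add: frobenius_fixed_def nat_pow_pow power_add mult.commute)
    then show ?case
      using that Suc by (simp add: frobenius_fixed_def)
  qed (use that in \<open>simp add: frobenius_fixed_def\<close>)
  then show ?thesis
    by (auto simp: n frobenius_fixed_def)
qed

section \<open>Roots\<close>

lemma (in ring) eval_map_rev:
  assumes "a ` {..<n} \<subseteq> carrier R" "x \<in> carrier R"
  shows "eval (map a (rev [0..<n])) x = (\<Oplus>i\<in>{..<n}. a i \<otimes> x [^] i)"
  using assms(1)
proof (induction n)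
  case (Suc n)
  have a: "a n \<in> carrier R" "a ` {..<n} \<subseteq> carrier R"
    using Suc.prems by auto
  then show ?case
    using assms(2) Suc.IH by (simp add: lessThan_Suc Pi_def image_subset_iff)
qed simp

text \<open>Polynomials are coefficient lists with the leading coefficient first, hence the reversed
  range; \<open>a n \<noteq> \<zero>\<close> makes the list normalised, so that its length
  determines the degree.\<close>

lemma (in field) poly_of_coeffs:
  assumes "a ` {..(n::nat)} \<subseteq> carrier R" "a n \<noteq> \<zero>"
  obtains P where "P \<in> carrier (poly_ring R)" "degree P = n"
    "\<And>x. x \<in> carrier R \<Longrightarrow> eval P x = (\<Oplus>i\<in>{..n}. a i \<otimes> x [^] i)"
proof
  let ?P = "map a (rev [0..<Suc n])"
  show "?P \<in> carrier (poly_ring R)"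
    using assms by (auto simp: univ_poly_def polynomial_def image_subset_iff)
  show "degree ?P = n"
    by simp
  show "eval ?P x = (\<Oplus>i\<in>{..n}. a i \<otimes> x [^] i)" if "x \<in> carrier R" for x
    using eval_map_rev[of a "Suc n" x] assms that by (simp only: lessThan_Suc_atMost)
qed

lemma (in field) finite_roots:
  assumes "a ` {..(n::nat)} \<subseteq> carrier R" "a n \<noteq> \<zero>"
  shows "finite {x \<in> carrier R. (\<Oplus>i\<in>{..n}. a i \<otimes> x [^] i) = \<zero>}"
proof -
  obtain P where P: "P \<in> carrier (poly_ring R)" "degree P = n"
    and ev: "\<And>x. x \<in> carrier R \<Longrightarrow> eval P x = (\<Oplus>i\<in>{..n}. a i \<otimes> x [^] i)"
    using poly_of_coeffs[OF assms] by blast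
  show ?thesis
  proof (cases "P = []")
    \<comment> \<open>The properties obtained for \<open>P\<close> do not exclude the empty list,
      which also has degree zero. Then \<open>n = 0\<close>, and the nonzero constant
      \<open>a 0\<close> has no root.\<close>
    case True
    then have n: "n = 0"
      using P(2) by simp
    have "a 0 \<noteq> \<zero>" "a 0 \<in> carrier R"
      using assms n by auto
    then show ?thesis
      by (simp add: n)
  next
    case False
    have "{x \<in> carrier R. (\<Oplus>i\<in>{..n}. a i \<otimes> x [^] i) = \<zero>} \<subseteq> {x. is_root P x}"
      using False by (auto simp: is_root_def ev)
    then show ?thesis
      using finite_number_of_roots[OF P(1)] finite_subset by blast
  qed
qed

lemma (in algebraically_closed) exists_root_coeffs:
  assumes "a ` {..(n::nat)} \<subseteq> carrier L" "a n \<noteq> \<zero>" "0 < n"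
  shows "\<exists>x\<in>carrier L. (\<Oplus>i\<in>{..n}. a i \<otimes> x [^] i) = \<zero>"
proof -
  obtain P where P: "P \<in> carrier (poly_ring L)" "degree P = n"
    and ev: "\<And>x. x \<in> carrier L \<Longrightarrow> eval P x = (\<Oplus>i\<in>{..n}. a i \<otimes> x [^] i)"
    using poly_of_coeffs[OF assms(1,2)] by blast
  have "size (roots P) = n"
    using roots_over_carrier[OF P(1)] P(2) by (simp add: splitted_def)
  then obtain x where "x \<in># roots P"
    using assms(3) by (metis less_irrefl multiset_nonemptyE size_empty)
  then have "is_root P x"
    using roots_mem_iff_is_root[OF P(1)] by simp
  then show ?thesis
    using ev by (auto simp: is_root_def)
qed

lemma (in field) finite_frobenius_fixed:
  assumes "1 < q"
  shows "finite (frobenius_fixed R q)"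
proof -
  \<comment> \<open>The coefficients of X^q - X; \<open>1 < q\<close> keeps the positions 1 and
    \<open>q\<close> apart.\<close>
  define a where "a i = (if i = q then \<one> else if i = 1 then \<ominus> \<one> else \<zero>)" for i :: nat
  have "(\<Oplus>i\<in>{..q}. a i \<otimes> x [^] i) = x [^] q \<ominus> x" if x: "x \<in> carrier R" for x
  proof -
    have "(\<Oplus>i\<in>{..q}. a i \<otimes> x [^] i) = (\<Oplus>i\<in>{1, q}. a i \<otimes> x [^] i)"
      using x assms by (intro add.finprod_mono_neutral_cong_right) (auto simp: a_def)
    also have "\<dots> = x [^] q \<ominus> x"
      using x assms by (simp add: a_def Pi_def a_minus_def l_minus a_comm)
    finally show ?thesis .
  qed
  moreover have "finite {x \<in> carrier R. (\<Oplus>i\<in>{..q}. a i \<otimes> x [^] i) = \<zero>}"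
    by (rule finite_roots) (auto simp: a_def)
  ultimately show ?thesis
    unfolding frobenius_fixed_def by (rule_tac finite_subset) (auto simp: r_right_minus_eq)
qed

section \<open>Extending homomorphisms\<close>

lemma (in ring) finsum_in_subring:
  assumes M: "subring M R" and f: "\<And>i. i \<in> I \<Longrightarrow> f i \<in> M"
  shows "(\<Oplus>i\<in>I. f i) \<in> M"
  using f
proof (induction I rule: infinite_finite_induct)
  case (insert i I)
  then show ?case
    using subringE(1,7)[OF M] by (subst finsum_insert) auto
qed (use subringE(2)[OF M] in auto)

lemma (in monoid) nat_pow_in_submonoid:
  assumes "submonoid M G" "x \<in> M"
  shows "x [^] (n::nat) \<in> M"
  using assms by (induction n) (auto simp: submonoid.one_closed submonoid.m_closed)

lemma (in domain) pow_non_zero: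
  assumes "x \<in> carrier R" "x \<noteq> \<zero>"
  shows "x [^] (n::nat) \<noteq> \<zero>"
  using assms by (induction n) (auto simp: integral_iff)

text \<open>The homomorphism theorem without a quotient ring: \<open>\<gamma>\<close> evaluates
  \<open>\<beta>\<close> at a chosen preimage under \<open>\<alpha>\<close>, and the inclusion of
  kernels makes the choice irrelevant.\<close>

lemma ring_hom_factor:
  fixes F (structure)
  assumes A: "ring A" and F: "ring F" and C: "ring C"
    and \<alpha>: "\<alpha> \<in> ring_hom A F" and \<beta>: "\<beta> \<in> ring_hom A C"
    and ker: "\<And>g. g \<in> carrier A \<Longrightarrow> \<alpha> g = \<zero> \<Longrightarrow> \<beta> g = \<zero>\<^bsub>C\<^esub>"
  obtains \<gamma> where "\<gamma> \<in> ring_hom (F\<lparr>carrier := \<alpha> ` carrier A\<rparr>) C"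
    "\<And>g. g \<in> carrier A \<Longrightarrow> \<gamma> (\<alpha> g) = \<beta> g"
proof -
  interpret \<alpha>: ring_hom_ring A F \<alpha>
    using A F \<alpha> by (rule ring_hom_ringI2)
  interpret \<beta>: ring_hom_ring A C \<beta>
    using A C \<beta> by (rule ring_hom_ringI2)
  have wd: "\<beta> g = \<beta> h" if g: "g \<in> carrier A" and h: "h \<in> carrier A" and eq: "\<alpha> g = \<alpha> h" for g h
  proof -
    have "\<alpha> (g \<ominus>\<^bsub>A\<^esub> h) = \<zero>"
      using g h eq by (simp add: a_minus_def \<alpha>.S.r_neg)
    then have "\<beta> (g \<ominus>\<^bsub>A\<^esub> h) = \<zero>\<^bsub>C\<^esub>"
      using ker g h by simp
    then show ?thesis
      using g h by (simp add: a_minus_def \<beta>.S.minus_equality[symmetric] \<beta>.S.r_right_minus_eq[unfolded a_minus_def])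
  qed
  define \<gamma> where "\<gamma> y = \<beta> (inv_into (carrier A) \<alpha> y)" for y
  have \<gamma>: "\<gamma> (\<alpha> g) = \<beta> g" if "g \<in> carrier A" for g
    unfolding \<gamma>_def using that by (intro wd) (auto simp: f_inv_into_f inv_into_into)
  have "\<gamma> \<in> ring_hom (F\<lparr>carrier := \<alpha> ` carrier A\<rparr>) C"
  proof (rule ring_hom_memI)
    fix y z
    assume "y \<in> carrier (F\<lparr>carrier := \<alpha> ` carrier A\<rparr>)" "z \<in> carrier (F\<lparr>carrier := \<alpha> ` carrier A\<rparr>)"
    then obtain g h where gh: "g \<in> carrier A" "h \<in> carrier A" "y = \<alpha> g" "z = \<alpha> h"
      by auto
    then show "\<gamma> (y \<otimes>\<^bsub>F\<lparr>carrier := \<alpha> ` carrier A\<rparr>\<^esub> z) = \<gamma> y \<otimes>\<^bsub>C\<^esub> \<gamma> z"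
      using \<gamma>[of "g \<otimes>\<^bsub>A\<^esub> h"] by (simp add: \<gamma>)
    show "\<gamma> (y \<oplus>\<^bsub>F\<lparr>carrier := \<alpha> ` carrier A\<rparr>\<^esub> z) = \<gamma> y \<oplus>\<^bsub>C\<^esub> \<gamma> z"
      using \<gamma>[of "g \<oplus>\<^bsub>A\<^esub> h"] gh by (simp add: \<gamma>)
  next
    show "\<gamma> \<one>\<^bsub>F\<lparr>carrier := \<alpha> ` carrier A\<rparr>\<^esub> = \<one>\<^bsub>C\<^esub>"
      using \<gamma>[of "\<one>\<^bsub>A\<^esub>"] by simp
  qed (auto simp: \<gamma>)
  then show ?thesis
    using \<gamma> that by blast
qed

text \<open>For a subring \<open>M\<close> of a field this says that \<open>M\<close> is an
  algebraically closed field: inverses arise as roots of linear polynomials. Coefficient functions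
  and sums in \<open>C\<close> let it be stated without a polynomial ring over
  \<open>M\<close>.\<close>

definition root_closed :: "('c, 'n) ring_scheme \<Rightarrow> 'c set \<Rightarrow> bool" where
  "root_closed C M \<longleftrightarrow> (\<forall>a. \<forall>n::nat. 0 < n \<longrightarrow> a ` {..n} \<subseteq> M \<longrightarrow> a n \<noteq> \<zero>\<^bsub>C\<^esub> \<longrightarrow>
     (\<exists>c\<in>M. (\<Oplus>\<^bsub>C\<^esub>i\<in>{..n}. a i \<otimes>\<^bsub>C\<^esub> c [^]\<^bsub>C\<^esub> i) = \<zero>\<^bsub>C\<^esub>))"

text \<open>The induction hypothesis for adjoining generators. The homomorphisms have target
  \<open>C\<close> and image in \<open>M\<close>, so that all computations take place in the one
  field \<open>C\<close>.\<close>

definition separated_by_homs ::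
    "('f, 'l) ring_scheme \<Rightarrow> ('c, 'n) ring_scheme \<Rightarrow> 'c set \<Rightarrow> 'f set \<Rightarrow> bool" where
  "separated_by_homs F C M S \<longleftrightarrow> (\<forall>u\<in>S. u \<noteq> \<zero>\<^bsub>F\<^esub> \<longrightarrow>
     (\<exists>\<phi>\<in>ring_hom (F\<lparr>carrier := S\<rparr>) C. \<phi> ` S \<subseteq> M \<and> \<phi> u \<noteq> \<zero>\<^bsub>C\<^esub>))"

section \<open>Adjoining one element to a separated subring\<close>

locale simple_subring_extension =
  F: field F + C: field C for F :: "('f, 'l) ring_scheme" and C :: "('c, 'n) ring_scheme" +
  fixes M :: "'c set" and S :: "'f set" and x :: 'f
  assumes M: "subring M C" and roots: "root_closed C M" and S: "subring S F"
    and separated: "separated_by_homs F C M S" and x: "x \<in> carrier F"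
begin

abbreviation "R \<equiv> F\<lparr>carrier := S\<rparr>"
abbreviation "P \<equiv> UP R"
abbreviation "ev \<equiv> eval R F id x"
abbreviation "evC \<phi> c \<equiv> eval R C \<phi> c"

sublocale R: "domain" R
  using F.subring_is_domain[OF S] .

sublocale P: UP_domain R P
  by unfold_locales simp

sublocale ev: UP_pre_univ_prop R F id P
proof -
  have "id \<in> ring_hom R F"
    using subringE(1)[OF S] by (auto simp: ring_hom_def)
  then show "UP_pre_univ_prop R F id"
    by unfold_locales auto
qed

sublocale ev: ring_hom_cring P F ev
  using ev.eval_ring_hom[OF x] by (rule ev.ring_homD)

text \<open>This is the subring \<open>S[x]\<close> of \<open>F\<close>, as the image of the
  polynomial ring under evaluation at \<open>x\<close>.\<close>

definition extension :: "'f set" where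
  "extension = ev ` carrier P"

lemma evC_hom:
  assumes "\<phi> \<in> ring_hom R C" "c \<in> carrier C"
  shows "ring_hom_cring P C (evC \<phi> c)" "\<And>r. r \<in> S \<Longrightarrow> evC \<phi> c (monom P r 0) = \<phi> r"
proof -
  interpret \<phi>: UP_pre_univ_prop R C \<phi> P
    using assms by unfold_locales auto
  show "ring_hom_cring P C (evC \<phi> c)"
    using \<phi>.eval_ring_hom[OF assms(2)] by (rule \<phi>.ring_homD)
  show "\<And>r. r \<in> S \<Longrightarrow> evC \<phi> c (monom P r 0) = \<phi> r"
    using \<phi>.eval_const[OF assms(2)] by simp
qed

lemma evC_eq:
  assumes "g \<in> carrier P"
  shows "evC \<phi> c g = (\<Oplus>\<^bsub>C\<^esub>i\<in>{..deg R g}. \<phi> (coeff P g i) \<otimes>\<^bsub>C\<^esub> c [^]\<^bsub>C\<^esub> i)"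
  using assms by (simp add: P.eval_on_carrier)

lemma evC_in:
  assumes "\<phi> ` S \<subseteq> M" "c \<in> M" "g \<in> carrier P"
  shows "evC \<phi> c g \<in> M"
proof -
  have "\<phi> (coeff P g i) \<in> M" for i
    using P.coeff_closed[OF assms(3)] assms(1) by auto
  then show ?thesis
    unfolding evC_eq[OF assms(3)]
    using subringE(6)[OF M] C.nat_pow_in_submonoid[OF subring.axioms(2)[OF M] assms(2)]
    by (intro C.finsum_in_subring[OF M]) auto
qed

text \<open>Reduces the construction of a homomorphism on \<open>S[x]\<close> to the choice of
  \<open>\<phi>\<close> on \<open>S\<close> and of a value \<open>c\<close> for \<open>x\<close>:
  the evaluation \<open>evC \<phi> c\<close> descends from polynomials to \<open>S[x]\<close> once
  it respects the relations satisfied by \<open>x\<close>.\<close>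

lemma extension_hom:
  assumes \<phi>: "\<phi> \<in> ring_hom R C" "\<phi> ` S \<subseteq> M" and c: "c \<in> M"
    and ker: "\<And>g. g \<in> carrier P \<Longrightarrow> ev g = \<zero>\<^bsub>F\<^esub> \<Longrightarrow> evC \<phi> c g = \<zero>\<^bsub>C\<^esub>"
    and g: "g \<in> carrier P" "evC \<phi> c g \<noteq> \<zero>\<^bsub>C\<^esub>"
  shows "\<exists>\<psi>\<in>ring_hom (F\<lparr>carrier := extension\<rparr>) C. \<psi> ` extension \<subseteq> M \<and> \<psi> (ev g) \<noteq> \<zero>\<^bsub>C\<^esub>"
proof -
  have cC: "c \<in> carrier C"
    using c subringE(1)[OF M] by auto
  interpret evC: ring_hom_cring P C "evC \<phi> c"
    using evC_hom(1)[OF \<phi>(1) cC] .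
  obtain \<psi> where "\<psi> \<in> ring_hom (F\<lparr>carrier := extension\<rparr>) C"
    "\<And>g. g \<in> carrier P \<Longrightarrow> \<psi> (ev g) = evC \<phi> c g"
    using ring_hom_factor[OF P.P.ring_axioms F.ring_axioms C.ring_axioms ev.homh evC.homh ker]
    unfolding extension_def by blast
  then show ?thesis
    using g evC_in[OF \<phi>(2) c] by (intro bexI[of _ \<psi>]) (auto simp: extension_def)
qed

text \<open>There are no relations on \<open>x\<close>, so any \<open>c\<close> in \<open>M\<close>
  is an admissible image; it only has to avoid the roots of \<open>\<phi>(g)\<close>. Keeping the
  leading coefficient of \<open>g\<close> nonzero gives X * \<open>\<phi>(g)\<close> - 1 positive
  degree, even when \<open>g\<close> is constant.\<close>

lemma separated_extension_transcendental:
  assumes inj: "\<And>g. g \<in> carrier P \<Longrightarrow> ev g = \<zero>\<^bsub>F\<^esub> \<Longrightarrow> g = \<zero>\<^bsub>P\<^esub>"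
    and g: "g \<in> carrier P" "ev g \<noteq> \<zero>\<^bsub>F\<^esub>"
  shows "\<exists>\<psi>\<in>ring_hom (F\<lparr>carrier := extension\<rparr>) C. \<psi> ` extension \<subseteq> M \<and> \<psi> (ev g) \<noteq> \<zero>\<^bsub>C\<^esub>"
proof -
  let ?n = "deg R g"
  have "g \<noteq> \<zero>\<^bsub>P\<^esub>"
    using g(2) by auto
  then have "coeff P g ?n \<noteq> \<zero>\<^bsub>F\<^esub>" "coeff P g ?n \<in> S"
    using P.lcoeff_nonzero2[OF g(1)] P.coeff_closed[OF g(1)] by auto
  then obtain \<phi> where \<phi>: "\<phi> \<in> ring_hom R C" "\<phi> ` S \<subseteq> M" "\<phi> (coeff P g ?n) \<noteq> \<zero>\<^bsub>C\<^esub>"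
    using separated unfolding separated_by_homs_def by blast
  have coeff_M: "\<phi> (coeff P g i) \<in> M" for i
    using P.coeff_closed[OF g(1)] \<phi>(2) by auto
  note coeff_C = subsetD[OF subringE(1)[OF M] coeff_M]
  \<comment> \<open>A root of \<open>X * \<phi>(g) - 1\<close> is not a root of \<open>\<phi>(g)\<close>.\<close>
  define a where "a i = (case i of 0 \<Rightarrow> \<ominus>\<^bsub>C\<^esub> \<one>\<^bsub>C\<^esub> | Suc j \<Rightarrow> \<phi> (coeff P g j))" for i
  have "a ` {..Suc ?n} \<subseteq> M"
    using coeff_M subringE(3,5)[OF M] by (auto simp: a_def split: nat.split)
  moreover have "a (Suc ?n) \<noteq> \<zero>\<^bsub>C\<^esub>"
    using \<phi>(3) by (simp add: a_def)
  ultimately obtain c where c: "c \<in> M" "(\<Oplus>\<^bsub>C\<^esub>i\<in>{..Suc ?n}. a i \<otimes>\<^bsub>C\<^esub> c [^]\<^bsub>C\<^esub> i) = \<zero>\<^bsub>C\<^esub>"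
    using roots unfolding root_closed_def by blast
  have cC: "c \<in> carrier C"
    using c subringE(1)[OF M] by auto
  have "(\<Oplus>\<^bsub>C\<^esub>i\<in>{..Suc ?n}. a i \<otimes>\<^bsub>C\<^esub> c [^]\<^bsub>C\<^esub> i) =
      (\<Oplus>\<^bsub>C\<^esub>i\<in>{..?n}. a (Suc i) \<otimes>\<^bsub>C\<^esub> c [^]\<^bsub>C\<^esub> Suc i) \<oplus>\<^bsub>C\<^esub> a 0 \<otimes>\<^bsub>C\<^esub> c [^]\<^bsub>C\<^esub> (0::nat)"
    using cC coeff_C by (subst C.finsum_Suc2) (auto simp: a_def split: nat.split)
  also have "\<dots> = (\<Oplus>\<^bsub>C\<^esub>i\<in>{..?n}. \<phi> (coeff P g i) \<otimes>\<^bsub>C\<^esub> c [^]\<^bsub>C\<^esub> i \<otimes>\<^bsub>C\<^esub> c) \<ominus>\<^bsub>C\<^esub> \<one>\<^bsub>C\<^esub>"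
    using cC coeff_C by (simp add: a_def a_minus_def C.m_assoc Pi_def)
  also have "\<dots> = evC \<phi> c g \<otimes>\<^bsub>C\<^esub> c \<ominus>\<^bsub>C\<^esub> \<one>\<^bsub>C\<^esub>"
    using cC coeff_C by (simp add: evC_eq[OF g(1)] C.finsum_ldistr Pi_def)
  finally have "evC \<phi> c g \<otimes>\<^bsub>C\<^esub> c \<ominus>\<^bsub>C\<^esub> \<one>\<^bsub>C\<^esub> = \<zero>\<^bsub>C\<^esub>"
    using c(2) by simp
  then have "evC \<phi> c g \<noteq> \<zero>\<^bsub>C\<^esub>"
    using cC by (auto simp: a_minus_def)
  moreover have "evC \<phi> c h = \<zero>\<^bsub>C\<^esub>" if "h \<in> carrier P" "ev h = \<zero>\<^bsub>F\<^esub>" for h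
  proof -
    interpret evC: ring_hom_cring P C "evC \<phi> c"
      using evC_hom(1)[OF \<phi>(1) cC] .
    show ?thesis
      using inj[OF that] by simp
  qed
  ultimately show ?thesis
    using extension_hom[OF \<phi>(1,2) c(1)] g(1) by blast
qed

text \<open>As \<open>S\<close> is only a domain, division with remainder requires multiplying by
  powers of the divisor's leading coefficient. Hence \<open>\<phi>\<close> must keep the leading
  coefficient of \<open>f\<close> nonzero: this gives the image of \<open>f\<close> a root
  \<open>c\<close> and allows those powers to be cancelled in \<open>C\<close>. The second demand on
  \<open>\<phi>\<close> comes from \<open>g\<close> and is condensed into one constant
  \<open>t\<close> of \<open>S\<close>.\<close>

lemma separated_extension_algebraic:
  assumes f: "f \<in> carrier P" "f \<noteq> \<zero>\<^bsub>P\<^esub>" "ev f = \<zero>\<^bsub>F\<^esub>"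
    and least: "\<And>h. h \<in> carrier P \<Longrightarrow> h \<noteq> \<zero>\<^bsub>P\<^esub> \<Longrightarrow> ev h = \<zero>\<^bsub>F\<^esub> \<Longrightarrow> deg R f \<le> deg R h"
    and g: "g \<in> carrier P" "ev g \<noteq> \<zero>\<^bsub>F\<^esub>"
  shows "\<exists>\<psi>\<in>ring_hom (F\<lparr>carrier := extension\<rparr>) C. \<psi> ` extension \<subseteq> M \<and> \<psi> (ev g) \<noteq> \<zero>\<^bsub>C\<^esub>"
proof -
  let ?n = "deg R f"
  have ev_smult: "ev (r \<odot>\<^bsub>P\<^esub> h) = r \<otimes>\<^bsub>F\<^esub> ev h" if "r \<in> S" "h \<in> carrier P" for r h
    using that ev.eval_const[OF x, of r] by (simp add: P.monom_mult_is_smult[symmetric])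
  have lcoeff: "coeff P h (deg R h) \<in> S" "coeff P h (deg R h) [^]\<^bsub>R\<^esub> (k::nat) \<in> S"
    "coeff P h (deg R h) [^]\<^bsub>R\<^esub> k \<noteq> \<zero>\<^bsub>F\<^esub>"
    if "h \<in> carrier P" "h \<noteq> \<zero>\<^bsub>P\<^esub>" for h k
    using P.lcoeff_nonzero2[OF that] P.coeff_closed[OF that(1)]
      R.nat_pow_closed[of "coeff P h (deg R h)"] R.pow_non_zero[of "coeff P h (deg R h)"] by auto
  have S_F: "r \<in> S \<Longrightarrow> r \<in> carrier F" for r
    using subringE(1)[OF S] by auto
  have least_zero: "h = \<zero>\<^bsub>P\<^esub>" if "h \<in> carrier P" "ev h = \<zero>\<^bsub>F\<^esub>" "deg R h < ?n" for h
    using least[OF that(1) _ that(2)] that(3) by (rule_tac ccontr) simp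

  \<comment> \<open>Since \<open>f\<close> has minimal degree, an element of least degree among the multiples of \<open>g\<close>
    modulo \<open>f\<close> not vanishing at \<open>x\<close> is a constant \<open>t\<close>, so a homomorphism keeping \<open>t\<close> nonzero
    keeps \<open>ev g\<close> nonzero.\<close>
  define I where "I = {h \<in> carrier P. ev h \<noteq> \<zero>\<^bsub>F\<^esub> \<and> (\<exists>A\<in>carrier P. ev h = ev A \<otimes>\<^bsub>F\<^esub> ev g)}"
  have "g \<in> I"
    using g by (auto simp: I_def intro!: bexI[of _ "\<one>\<^bsub>P\<^esub>"])
  then obtain r where r: "r \<in> I" and r_least: "\<And>h. h \<in> I \<Longrightarrow> deg R r \<le> deg R h"
    using ex_has_least_nat[of "\<lambda>h. h \<in> I" g "deg R"] by blast
  have rP: "r \<in> carrier P" and r0: "ev r \<noteq> \<zero>\<^bsub>F\<^esub>"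
    using r by (auto simp: I_def)
  have r_nz: "r \<noteq> \<zero>\<^bsub>P\<^esub>"
    using r0 by auto
  obtain A where A: "A \<in> carrier P" "ev r = ev A \<otimes>\<^bsub>F\<^esub> ev g"
    using r by (auto simp: I_def)
  \<comment> \<open>Divide \<open>r\<close> by \<open>f\<close>: the remainder has the value
    \<open>?d\<close> times \<open>ev r\<close> at \<open>x\<close>, so it is again in
    \<open>I\<close>, and the minimality of \<open>r\<close> bounds \<open>deg R r\<close> by its
    degree.\<close>
  have deg_r_less: "deg R r < ?n"
  proof -
    obtain q s k where qs: "q \<in> carrier P" "s \<in> carrier P" "s = \<zero>\<^bsub>P\<^esub> \<or> deg R s < deg R f"
      and eq: "coeff P f ?n [^]\<^bsub>R\<^esub> (k::nat) \<odot>\<^bsub>P\<^esub> r = f \<otimes>\<^bsub>P\<^esub> q \<oplus>\<^bsub>P\<^esub> s"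
      using P.long_div_theorem[OF f(1) rP f(2)] by blast
    let ?d = "coeff P f ?n [^]\<^bsub>R\<^esub> k"
    have d: "?d \<in> S" "?d \<noteq> \<zero>\<^bsub>F\<^esub>"
      using lcoeff[OF f(1,2)] by auto
    have "ev s = ?d \<otimes>\<^bsub>F\<^esub> ev r"
      using arg_cong[OF eq, of ev] qs f rP d by (simp add: ev_smult)
    then have "ev s \<noteq> \<zero>\<^bsub>F\<^esub>" "ev s = ev (?d \<odot>\<^bsub>P\<^esub> A) \<otimes>\<^bsub>F\<^esub> ev g"
      using r0 d rP A g S_F F.integral_iff by (auto simp: ev_smult F.m_assoc)
    then have "s \<in> I"
      using qs A(1) d(1) by (auto simp: I_def)
    then show ?thesis
      using r_least[of s] qs(3) \<open>ev s \<noteq> _\<close> by auto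
  qed
  \<comment> \<open>Otherwise divide \<open>f\<close> by \<open>r\<close>. A remainder not vanishing
    at \<open>x\<close> would lie in \<open>I\<close> with smaller degree than \<open>r\<close>; a
    remainder vanishing at \<open>x\<close> is zero by the minimality of \<open>f\<close>. So a
    multiple of \<open>f\<close> is \<open>r\<close> times \<open>q\<close>, and since
    \<open>ev r\<close> is nonzero, \<open>q\<close> vanishes at \<open>x\<close> although its
    degree is below that of \<open>f\<close>.\<close>
  have deg_r: "deg R r = 0"
  proof (rule ccontr)
    assume pos: "deg R r \<noteq> 0"
    obtain q s k where qs: "q \<in> carrier P" "s \<in> carrier P" "s = \<zero>\<^bsub>P\<^esub> \<or> deg R s < deg R r"
      and eq: "coeff P r (deg R r) [^]\<^bsub>R\<^esub> (k::nat) \<odot>\<^bsub>P\<^esub> f = r \<otimes>\<^bsub>P\<^esub> q \<oplus>\<^bsub>P\<^esub> s"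
      using P.long_div_theorem[OF rP f(1) r_nz] by blast
    let ?d = "coeff P r (deg R r) [^]\<^bsub>R\<^esub> k"
    have d: "?d \<in> S" "?d \<noteq> \<zero>\<^bsub>F\<^esub>"
      using lcoeff[OF rP r_nz] by auto
    have ev_eq: "ev r \<otimes>\<^bsub>F\<^esub> ev q \<oplus>\<^bsub>F\<^esub> ev s = \<zero>\<^bsub>F\<^esub>"
      using arg_cong[OF eq, of ev] qs f rP d S_F by (simp add: ev_smult)
    have "ev s = \<ominus>\<^bsub>F\<^esub> (ev r \<otimes>\<^bsub>F\<^esub> ev q)"
      using ev_eq qs rP by (metis F.a_comm F.minus_equality F.m_closed ev.hom_closed)
    then have "ev s = ev (\<ominus>\<^bsub>P\<^esub> (A \<otimes>\<^bsub>P\<^esub> q)) \<otimes>\<^bsub>F\<^esub> ev g"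
      using A qs g by (simp add: F.l_minus F.r_minus F.m_ac)
    moreover have "\<ominus>\<^bsub>P\<^esub> (A \<otimes>\<^bsub>P\<^esub> q) \<in> carrier P"
      using A qs by simp
    ultimately have "s \<in> I" if "ev s \<noteq> \<zero>\<^bsub>F\<^esub>"
      using that qs unfolding I_def by blast
    then have s0: "ev s = \<zero>\<^bsub>F\<^esub>"
      using r_least[of s] qs(3) by (metis ev.hom_zero leD)
    have s: "s = \<zero>\<^bsub>P\<^esub>"
      using least_zero[OF qs(2) s0] qs(3) deg_r_less by linarith
    have "ev r \<otimes>\<^bsub>F\<^esub> ev q = \<zero>\<^bsub>F\<^esub>"
      using ev_eq s0 rP qs by simp
    then have evq: "ev q = \<zero>\<^bsub>F\<^esub>"
      using F.integral_iff[of "ev r" "ev q"] r0 rP qs by simp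
    have eq': "?d \<odot>\<^bsub>P\<^esub> f = r \<otimes>\<^bsub>P\<^esub> q"
      using eq s rP qs by simp
    have df: "deg R (?d \<odot>\<^bsub>P\<^esub> f) = deg R f"
      using d f by simp
    have q: "q \<noteq> \<zero>\<^bsub>P\<^esub>"
    proof
      assume "q = \<zero>\<^bsub>P\<^esub>"
      then have "deg R f = 0"
        using df eq' rP by simp
      then show False
        using deg_r_less by simp
    qed
    have "deg R f = deg R r + deg R q"
      using df eq' rP qs r_nz q by simp
    then show False
      using least[OF qs(1) q evq] pos by simp
  qed
  define t where "t = coeff P r 0"
  have t: "t \<in> S" "r = monom P t 0"
    using P.coeff_closed[OF rP] P.deg_zero_impl_monom[OF rP deg_r] by (auto simp: t_def)
  have t0: "t \<noteq> \<zero>\<^bsub>F\<^esub>"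
    using t r0 ev.eval_const[OF x, of t] by auto
  let ?l = "coeff P f ?n"
  have l: "?l \<in> S" "?l \<noteq> \<zero>\<^bsub>F\<^esub>"
    using lcoeff(1)[OF f(1,2)] P.lcoeff_nonzero2[OF f(1,2)] by auto
  \<comment> \<open>Separation protects only one element, so the two demands are combined into a
    product.\<close>
  have "t \<otimes>\<^bsub>F\<^esub> ?l \<in> S" "t \<otimes>\<^bsub>F\<^esub> ?l \<noteq> \<zero>\<^bsub>F\<^esub>"
    using l t t0 subringE(6)[OF S] S_F F.integral_iff by auto
  then obtain \<phi> where \<phi>: "\<phi> \<in> ring_hom R C" "\<phi> ` S \<subseteq> M" "\<phi> (t \<otimes>\<^bsub>F\<^esub> ?l) \<noteq> \<zero>\<^bsub>C\<^esub>"
    using separated unfolding separated_by_homs_def by blast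
  interpret \<phi>: ring_hom_cring R C \<phi>
    using \<phi>(1) by unfold_locales
  have "\<phi> t \<otimes>\<^bsub>C\<^esub> \<phi> ?l \<noteq> \<zero>\<^bsub>C\<^esub>"
    using \<phi>(3) \<phi>.hom_mult[of t ?l] t l by simp
  then have \<phi>0: "\<phi> t \<noteq> \<zero>\<^bsub>C\<^esub>" "\<phi> ?l \<noteq> \<zero>\<^bsub>C\<^esub>"
    using \<phi>.hom_closed t l by auto
  have "(\<lambda>i. \<phi> (coeff P f i)) ` {..?n} \<subseteq> M"
    using P.coeff_closed[OF f(1)] \<phi>(2) by auto
  then obtain c where c: "c \<in> M" "(\<Oplus>\<^bsub>C\<^esub>i\<in>{..?n}. \<phi> (coeff P f i) \<otimes>\<^bsub>C\<^esub> c [^]\<^bsub>C\<^esub> i) = \<zero>\<^bsub>C\<^esub>"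
    using roots[unfolded root_closed_def, rule_format, of ?n "\<lambda>i. \<phi> (coeff P f i)"] \<phi>0(2) deg_r_less
    by auto
  have cC: "c \<in> carrier C"
    using c subringE(1)[OF M] by auto
  interpret evC: ring_hom_cring P C "evC \<phi> c"
    using evC_hom(1)[OF \<phi>(1) cC] .
  have evCf: "evC \<phi> c f = \<zero>\<^bsub>C\<^esub>"
    using c(2) by (simp add: evC_eq[OF f(1)])
  \<comment> \<open>\<open>f\<close> need not divide \<open>h\<close> over \<open>S\<close>; it
    divides \<open>?l [^] k\<close> times \<open>h\<close>, because the remainder vanishes at
    \<open>x\<close> and has too small a degree. In \<open>C\<close> the image of the power of
    \<open>?l\<close> is nonzero and can be cancelled.\<close>
  have ker: "evC \<phi> c h = \<zero>\<^bsub>C\<^esub>" if h: "h \<in> carrier P" "ev h = \<zero>\<^bsub>F\<^esub>" for h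
  proof -
    obtain q s k where qs: "q \<in> carrier P" "s \<in> carrier P" "s = \<zero>\<^bsub>P\<^esub> \<or> deg R s < deg R f"
      and eq: "?l [^]\<^bsub>R\<^esub> (k::nat) \<odot>\<^bsub>P\<^esub> h = f \<otimes>\<^bsub>P\<^esub> q \<oplus>\<^bsub>P\<^esub> s"
      using P.long_div_theorem[OF f(1) h(1) f(2)] by blast
    have d: "?l [^]\<^bsub>R\<^esub> k \<in> S"
      using lcoeff[OF f(1,2)] by auto
    have "ev s = \<zero>\<^bsub>F\<^esub>"
      using arg_cong[OF eq, of ev] qs f h d S_F by (simp add: ev_smult)
    then have "s = \<zero>\<^bsub>P\<^esub>"
      using least_zero[OF qs(2)] qs(3) by blast
    then have "?l [^]\<^bsub>R\<^esub> k \<odot>\<^bsub>P\<^esub> h = f \<otimes>\<^bsub>P\<^esub> q"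
      using eq qs f by simp
    then have "monom P (?l [^]\<^bsub>R\<^esub> k) 0 \<otimes>\<^bsub>P\<^esub> h = f \<otimes>\<^bsub>P\<^esub> q"
      using h d by (simp add: P.monom_mult_is_smult)
    from arg_cong[OF this, of "evC \<phi> c"]
    have "\<phi> (?l [^]\<^bsub>R\<^esub> k) \<otimes>\<^bsub>C\<^esub> evC \<phi> c h = \<zero>\<^bsub>C\<^esub>"
      using qs f h d evCf evC_hom(2)[OF \<phi>(1) cC d] by simp
    moreover have "\<phi> (?l [^]\<^bsub>R\<^esub> k) \<noteq> \<zero>\<^bsub>C\<^esub>"
      using \<phi>.hom_pow[of ?l k] l \<phi>0(2) C.pow_non_zero[of "\<phi> ?l" k] \<phi>.hom_closed[of ?l] by auto
    ultimately show ?thesis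
      using C.integral_iff[of "\<phi> (?l [^]\<^bsub>R\<^esub> k)" "evC \<phi> c h"] h d \<phi>.hom_closed[of "?l [^]\<^bsub>R\<^esub> k"] by auto
  qed
  \<comment> \<open>The relation \<open>ev r = ev A \<otimes> ev g\<close> survives in
    \<open>C\<close> by \<open>ker\<close>; its left side becomes \<open>\<phi> t\<close>, which is
    nonzero, hence so is the factor coming from \<open>g\<close>.\<close>
  have "ev (r \<ominus>\<^bsub>P\<^esub> A \<otimes>\<^bsub>P\<^esub> g) = \<zero>\<^bsub>F\<^esub>"
    using rP A g by (simp add: a_minus_def F.r_neg)
  then have "evC \<phi> c (r \<ominus>\<^bsub>P\<^esub> A \<otimes>\<^bsub>P\<^esub> g) = \<zero>\<^bsub>C\<^esub>"
    using ker rP A g by simp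
  then have "evC \<phi> c r = evC \<phi> c A \<otimes>\<^bsub>C\<^esub> evC \<phi> c g"
    using rP A g C.r_right_minus_eq[of "evC \<phi> c r" "evC \<phi> c A \<otimes>\<^bsub>C\<^esub> evC \<phi> c g"] by (simp add: a_minus_def)
  moreover have "evC \<phi> c r \<noteq> \<zero>\<^bsub>C\<^esub>"
    using \<phi>0(1) t evC_hom(2)[OF \<phi>(1) cC t(1)] by simp
  ultimately have "evC \<phi> c g \<noteq> \<zero>\<^bsub>C\<^esub>"
    using A by auto
  then show ?thesis
    using extension_hom[OF \<phi>(1,2) c(1) ker] g(1) by blast
qed

lemma separated_extension: "separated_by_homs F C M extension"
  unfolding separated_by_homs_def
proof (intro ballI impI)
  fix u
  assume "u \<in> extension" "u \<noteq> \<zero>\<^bsub>F\<^esub>"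
  then obtain g where g: "g \<in> carrier P" "ev g \<noteq> \<zero>\<^bsub>F\<^esub>" "u = ev g"
    by (auto simp: extension_def)
  define K where "K h \<longleftrightarrow> h \<in> carrier P \<and> h \<noteq> \<zero>\<^bsub>P\<^esub> \<and> ev h = \<zero>\<^bsub>F\<^esub>" for h
  show "\<exists>\<psi>\<in>ring_hom (F\<lparr>carrier := extension\<rparr>) C. \<psi> ` extension \<subseteq> M \<and> \<psi> u \<noteq> \<zero>\<^bsub>C\<^esub>"
  proof (cases "\<exists>h. K h")
    case False
    then show ?thesis
      using separated_extension_transcendental[OF _ g(1,2)] g(3) by (auto simp: K_def)
  next
    case True
    then obtain f where f: "K f" "\<And>h. K h \<Longrightarrow> deg R f \<le> deg R h"
      using ex_has_least_nat[of K _ "deg R"] by blast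
    show ?thesis
      unfolding g(3) using f g(1,2) by (intro separated_extension_algebraic[of f]) (auto simp: K_def)
  qed
qed

lemma subring_extension: "subring extension F"
  unfolding extension_def
  using ring_hom_ring.img_is_subring[OF ring_hom_ringI2[OF P.P.ring_axioms F.ring_axioms ev.homh]
      P.P.carrier_is_subring] .

lemma subset_extension: "S \<subseteq> extension"
proof
  fix r
  assume r: "r \<in> S"
  then have "ev (monom P r 0) = r"
    using ev.eval_const[OF x, of r] by simp
  then show "r \<in> extension"
    using P.monom_closed[of r 0] r unfolding extension_def by (intro image_eqI[of _ _ "monom P r 0"]) auto
qed

lemma generator_in_extension: "x \<in> extension"
  using ev.eval_monom1[OF x] unfolding extension_def
  by (auto intro!: image_eqI[of _ _ "monom P \<one>\<^bsub>F\<^esub> 1"] P.monom_closed[OF R.one_closed, simplified])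

end

lemma exists_separated_subring:
  fixes F :: "('f, 'l) ring_scheme" and C :: "('c, 'n) ring_scheme"
  assumes F: "field F" and C: "field C"
    and M: "subring M C" "root_closed C M" and S: "subring S F" "separated_by_homs F C M S"
    and A: "finite A" "A \<subseteq> carrier F"
  obtains T where "subring T F" "A \<subseteq> T" "separated_by_homs F C M T"
proof -
  have "\<exists>T. subring T F \<and> A \<subseteq> T \<and> separated_by_homs F C M T"
    using A
  proof (induction A rule: finite_induct)
    case empty
    then show ?case
      using S by blast
  next
    case (insert x A)
    then obtain T where T: "subring T F" "A \<subseteq> T" "separated_by_homs F C M T"
      by blast
    interpret ext: simple_subring_extension F C M T x
      using F C M T insert.prems
      by (intro simple_subring_extension.intro simple_subring_extension_axioms.intro) auto
    show ?case
      using ext.subring_extension ext.separated_extension ext.subset_extension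
        ext.generator_in_extension T(2) by blast
  qed
  then show ?thesis
    using that by blast
qed

section \<open>Homomorphisms to finite fields\<close>

lemma ring_characteristic_add_pow:
  assumes "ring_characteristic F = p" "0 < p"
  shows "[p] \<cdot>\<^bsub>F\<^esub> \<one>\<^bsub>F\<^esub> = \<zero>\<^bsub>F\<^esub>"
proof -
  let ?Q = "\<lambda>n::nat. 0 < n \<and> [n] \<cdot>\<^bsub>F\<^esub> \<one>\<^bsub>F\<^esub> = \<zero>\<^bsub>F\<^esub>"
  have ex: "\<exists>n. ?Q n"
    using assms by (auto simp: ring_characteristic_def split: if_splits)
  then have "p = (LEAST n. ?Q n)"
    using assms(1) unfolding ring_characteristic_def by argo
  with LeastI_ex[OF ex] show ?thesis
    by metis
qed

text \<open>By division with remainder the least positive integer annihilating one divides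
  \<open>p\<close>, and nontriviality excludes that it is 1.\<close>

lemma (in ring) ring_characteristic_eq_prime:
  assumes p: "Factorial_Ring.prime (p::nat)" "[p] \<cdot> \<one> = \<zero>" and nontrivial: "\<one> \<noteq> \<zero>"
  shows "ring_characteristic R = p"
proof -
  let ?Q = "\<lambda>n::nat. 0 < n \<and> [n] \<cdot> \<one> = \<zero>"
  define n where "n = (LEAST n. ?Q n)"
  have p0: "0 < p"
    using p(1) by (rule prime_gt_0_nat)
  then have Q: "?Q n"
    unfolding n_def using p(2) by (intro LeastI[of ?Q p]) simp
  have "[(p mod n)] \<cdot> \<one> = \<zero>"
  proof -
    have "[p] \<cdot> \<one> = [(n * (p div n))] \<cdot> \<one> \<oplus> [(p mod n)] \<cdot> \<one>"
      using add.nat_pow_mult[of \<one> "n * (p div n)" "p mod n"] by simp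
    moreover have "[(n * (p div n))] \<cdot> \<one> = \<zero>"
      using Q add.nat_pow_pow[of \<one> "p div n" n] by (simp add: mult.commute)
    ultimately show ?thesis
      using p(2) by simp
  qed
  moreover have "p mod n < n"
    using Q by simp
  ultimately have "p mod n = 0"
    using not_less_Least[of "p mod n" ?Q] unfolding n_def[symmetric] by simp
  then have "n = 1 \<or> n = p"
    using p(1) by (auto simp: prime_nat_iff)
  moreover have "n \<noteq> 1"
    using Q nontrivial by auto
  ultimately show ?thesis
    using p0 p(2) unfolding ring_characteristic_def n_def[symmetric] by auto
qed

lemma ring_hom_add_pow:
  assumes "ring R" "ring S" "h \<in> ring_hom R S" "x \<in> carrier R"
  shows "h ([(n::nat)] \<cdot>\<^bsub>R\<^esub> x) = [n] \<cdot>\<^bsub>S\<^esub> h x"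
proof -
  interpret h: ring_hom_ring R S h
    using assms by (intro ring_hom_ringI2)
  show ?thesis
    using assms(4) by (induction n) simp_all
qed

section \<open>Elements periodic under the Frobenius map\<close>

lemma (in cring) frobenius_pow_finsum:
  assumes p: "Factorial_Ring.prime (p::nat)" "[p] \<cdot> \<one> = \<zero>"
    and f: "\<And>i. i \<in> I \<Longrightarrow> f i \<in> carrier R"
  shows "(\<Oplus>i\<in>I. f i) [^] (p ^ m) = (\<Oplus>i\<in>I. f i [^] (p ^ m))"
  using f
proof (induction I rule: infinite_finite_induct)
  case (insert i I)
  then show ?case
    by (simp add: frobenius_pow_add[OF p] Pi_def)
qed (simp_all add: frobenius_pow_zero[OF p(1)])

lemma (in "domain") frobenius_pow_inj:
  assumes p: "Factorial_Ring.prime (p::nat)" "[p] \<cdot> \<one> = \<zero>"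
    and xy: "x \<in> carrier R" "y \<in> carrier R" "x [^] (p ^ m) = y [^] (p ^ m)"
  shows "x = y"
proof -
  have "(x \<ominus> y) [^] (p ^ m) = \<zero>"
    using xy by (simp add: a_minus_def frobenius_pow_add[OF p] frobenius_pow_minus[OF p] r_neg)
  then have "x \<ominus> y = \<zero>"
    using pow_non_zero[of "x \<ominus> y" "p ^ m"] xy by auto
  then show ?thesis
    using xy by simp
qed

text \<open>The exponent zero is excluded, since every element of the carrier is fixed by the power
  \<open>p ^ 0\<close>.\<close>

definition frobenius_periodic :: "('f, 'l) ring_scheme \<Rightarrow> nat \<Rightarrow> 'f set" where
  "frobenius_periodic F p = (\<Union>m\<in>{0<..}. frobenius_fixed F (p ^ m))"

text \<open>The union is directed: a product of two periods is a period for both elements.\<close>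

lemma (in cring) finite_subset_frobenius_periodic:
  assumes "finite A" "A \<subseteq> frobenius_periodic R p"
  obtains m where "0 < m" "A \<subseteq> frobenius_fixed R (p ^ m)"
proof -
  have "\<exists>m>0. A \<subseteq> frobenius_fixed R (p ^ m)"
    using assms
  proof (induction A rule: finite_induct)
    case empty
    then show ?case by auto
  next
    case (insert x A)
    then obtain m k where m: "0 < m" "A \<subseteq> frobenius_fixed R (p ^ m)"
      and k: "0 < k" "x \<in> frobenius_fixed R (p ^ k)"
      by (auto simp: frobenius_periodic_def)
    then show ?case
      using frobenius_fixed_mono[of m "m * k" p] frobenius_fixed_mono[of k "m * k" p]
      by (intro exI[of _ "m * k"]) auto
  qed
  then show ?thesis
    using that by blast
qed

lemma (in cring) subring_frobenius_periodic:
  assumes p: "Factorial_Ring.prime (p::nat)" "[p] \<cdot> \<one> = \<zero>"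
  shows "subring (frobenius_periodic R p) R"
proof -
  note fixed = subringE[OF subring_frobenius_fixed[OF p]]
  have closed: "x \<otimes> y \<in> frobenius_periodic R p \<and> x \<oplus> y \<in> frobenius_periodic R p"
    if xy: "x \<in> frobenius_periodic R p" "y \<in> frobenius_periodic R p" for x y
  proof -
    obtain m where "0 < m" "{x, y} \<subseteq> frobenius_fixed R (p ^ m)"
      using finite_subset_frobenius_periodic[of "{x, y}" p] xy by auto
    then show ?thesis
      using fixed(6,7)[of x m y] by (auto simp: frobenius_periodic_def)
  qed
  show ?thesis
  proof (rule subringI)
    show "\<one> \<in> frobenius_periodic R p"
      using fixed(3)[of 1] unfolding frobenius_periodic_def by blast
  next
    fix x
    assume "x \<in> frobenius_periodic R p"
    then show "\<ominus> x \<in> frobenius_periodic R p"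
      using fixed(5)[of x] unfolding frobenius_periodic_def by blast
  qed (use closed in \<open>auto simp: frobenius_periodic_def frobenius_fixed_def\<close>)
qed

text \<open>The Frobenius orbit of a root stays within the finite set of roots, hence is periodic.\<close>

lemma (in algebraically_closed) root_closed_frobenius_periodic:
  assumes p: "Factorial_Ring.prime (p::nat)" "[p] \<cdot> \<one> = \<zero>"
  shows "root_closed L (frobenius_periodic L p)"
  unfolding root_closed_def
proof (intro allI impI)
  fix a and n :: nat
  assume n: "0 < n" and a: "a ` {..n} \<subseteq> frobenius_periodic L p" and an: "a n \<noteq> \<zero>"
  have aL: "a ` {..n} \<subseteq> carrier L"
    using a subringE(1)[OF subring_frobenius_periodic[OF p]] by blast
  then have aL': "a i \<in> carrier L" if "i \<le> n" for i
    using that by auto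
  obtain m where m: "0 < m" "a ` {..n} \<subseteq> frobenius_fixed L (p ^ m)"
    using finite_subset_frobenius_periodic[OF _ a] by auto
  let ?q = "p ^ m"
  define Z where "Z = {x \<in> carrier L. (\<Oplus>i\<in>{..n}. a i \<otimes> x [^] i) = \<zero>}"
  obtain c where c: "c \<in> Z"
    using exists_root_coeffs[OF aL an n] by (auto simp: Z_def)
  then have cL: "c \<in> carrier L"
    by (simp add: Z_def)
  \<comment> \<open>The power map is additive and multiplicative and fixes the coefficients
    \<open>a i\<close>, so it sends roots to roots.\<close>
  have Z_closed: "x [^] ?q \<in> Z" if "x \<in> Z" for x
  proof -
    have x: "x \<in> carrier L" "(\<Oplus>i\<in>{..n}. a i \<otimes> x [^] i) = \<zero>"
      using that by (auto simp: Z_def)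
    have "(\<Oplus>i\<in>{..n}. a i \<otimes> x [^] i) [^] ?q = (\<Oplus>i\<in>{..n}. (a i \<otimes> x [^] i) [^] ?q)"
      using x aL' by (intro frobenius_pow_finsum[OF p]) auto
    also have "\<dots> = (\<Oplus>i\<in>{..n}. a i \<otimes> (x [^] ?q) [^] i)"
    proof (rule finsum_cong')
      fix i
      assume "i \<in> {..n}"
      then have "a i \<in> carrier L" "a i [^] ?q = a i"
        using m by (auto simp: frobenius_fixed_def)
      then show "(a i \<otimes> x [^] i) [^] ?q = a i \<otimes> (x [^] ?q) [^] i"
        using x by (simp add: nat_pow_distrib nat_pow_pow mult.commute)
    qed (use x aL' in auto)
    finally show ?thesis
      using x frobenius_pow_zero[OF p(1), of m] by (simp add: Z_def)
  qed
  have orbit: "c [^] (?q ^ j) \<in> Z" for j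
  proof (induction j)
    case (Suc j)
    then show ?case
      using Z_closed[OF Suc] cL by (simp add: nat_pow_pow mult.commute)
  qed (use c in \<open>simp add: Z_def\<close>)
  have "finite Z"
    unfolding Z_def using aL an by (rule finite_roots)
  then have "\<not> inj (\<lambda>j. c [^] (?q ^ j))"
    using orbit finite_subset[of "range (\<lambda>j. c [^] (?q ^ j))" Z] range_inj_infinite by blast
  then obtain i j where ij: "i < j" "c [^] (?q ^ i) = c [^] (?q ^ j)"
    unfolding inj_on_def by (metis linorder_neqE_nat)
  \<comment> \<open>A collision makes the orbit only eventually periodic; the common part
    \<open>p ^ (m * i)\<close> of both exponents is then cancelled by injectivity of the Frobenius
    map, which leaves the period \<open>m * (j - i)\<close>.\<close>
  have "(c [^] (p ^ (m * (j - i)))) [^] (p ^ (m * i)) = c [^] (p ^ (m * i))"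
  proof -
    have "m * (j - i) + m * i = m * j"
      using ij(1) by (metis add_mult_distrib2 le_add_diff_inverse2 less_imp_le)
    then show ?thesis
      using ij cL by (simp add: nat_pow_pow power_add[symmetric] power_mult[symmetric])
  qed
  then have "c [^] (p ^ (m * (j - i))) = c"
    using frobenius_pow_inj[OF p] cL by blast
  then have "c \<in> frobenius_periodic L p"
    using cL m(1) ij(1) by (auto simp: frobenius_periodic_def frobenius_fixed_def intro!: bexI[of _ "m * (j - i)"])
  then show "\<exists>c\<in>frobenius_periodic L p. (\<Oplus>i\<in>{..n}. a i \<otimes> c [^] i) = \<zero>"
    using c by (auto simp: Z_def)
qed

lemma (in field) subfield_frobenius_fixed:
  assumes p: "Factorial_Ring.prime (p::nat)" "[p] \<cdot> \<one> = \<zero>"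
  shows "subfield (frobenius_fixed R (p ^ m)) R"
proof (rule subfieldI'[OF subring_frobenius_fixed[OF p]])
  fix k
  assume "k \<in> frobenius_fixed R (p ^ m) - {\<zero>}"
  then have k: "k \<in> carrier R" "k [^] (p ^ m) = k" "k \<in> Units R"
    by (auto simp: frobenius_fixed_def field_Units)
  then have "(inv k) [^] (p ^ m) \<otimes> k [^] (p ^ m) = \<one>"
    by (subst nat_pow_distrib[symmetric]) auto
  then have "(inv k) [^] (p ^ m) \<otimes> k = \<one>"
    by (simp only: k(2))
  then have "(inv k) [^] (p ^ m) = inv k"
    using k inv_unique'[of k "inv k [^] (p ^ m)"] by (simp add: m_comm)
  then show "inv k \<in> frobenius_fixed R (p ^ m)"
    using k(3) by (simp add: frobenius_fixed_def)
qed

theorem exists_hom_to_finite_field: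
  fixes F :: "('f, 'l) ring_scheme"
  assumes F: "field F" and p: "Factorial_Ring.prime (p::nat)" "[p] \<cdot>\<^bsub>F\<^esub> \<one>\<^bsub>F\<^esub> = \<zero>\<^bsub>F\<^esub>"
    and A: "finite A" "A \<subseteq> carrier F"
  obtains T and E :: "nat ring" and \<phi>
  where "subring T F" "A \<subseteq> T" "field E" "finite (carrier E)" "ring_characteristic E = p"
    "\<phi> \<in> ring_hom (F\<lparr>carrier := T\<rparr>) E"
proof -
  interpret F: field F by fact
  define C where "C = F.alg_closure"
  interpret C: algebraic_closure C "F.indexed_const ` carrier F"
    unfolding C_def by (rule F.alg_closureE)
  define \<iota> :: "'f \<Rightarrow> ('f list \<times> nat) multiset \<Rightarrow> 'f" where "\<iota> = F.indexed_const"
  have \<iota>: "\<iota> \<in> ring_hom F C"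
    unfolding C_def \<iota>_def by (rule F.alg_closureE)
  interpret \<iota>: ring_hom_ring F C \<iota>
    using F.ring_axioms C.ring_axioms \<iota> by (rule ring_hom_ringI2)
  have \<iota>_inj: "inj_on \<iota> (carrier F)"
  proof (rule \<iota>.non_trivial_field_hom_imp_inj[OF F])
    have "\<one>\<^bsub>C\<^esub> \<in> \<iota> ` carrier F"
      using \<iota>.hom_one by (metis F.one_closed image_eqI)
    then show "\<iota> ` carrier F \<noteq> {\<zero>\<^bsub>C\<^esub>}"
      using C.one_not_zero by blast
  qed
  have pC: "[p] \<cdot>\<^bsub>C\<^esub> \<one>\<^bsub>C\<^esub> = \<zero>\<^bsub>C\<^esub>"
    using ring_hom_add_pow[OF F.ring_axioms C.ring_axioms \<iota>, of "\<one>\<^bsub>F\<^esub>" p] p(2) by simp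
  define M where "M = frobenius_periodic C p"
  have M: "subring M C"
    unfolding M_def using p(1) pC by (rule C.subring_frobenius_periodic)
  have rc: "root_closed C M"
    unfolding M_def using p(1) pC by (rule C.root_closed_frobenius_periodic)
  \<comment> \<open>The induction starts at the prime field of \<open>F\<close>. There the injective
    embedding \<open>\<iota>\<close> alone keeps all nonzero elements nonzero, and its values
    satisfy the same equation \<open>c ^ p = c\<close>.\<close>
  let ?S = "frobenius_fixed F (p ^ 1)"
  have S: "subring ?S F"
    using p by (rule F.subring_frobenius_fixed)
  have "separated_by_homs F C M ?S"
    unfolding separated_by_homs_def
  proof (intro ballI impI bexI conjI)
    fix u
    assume u: "u \<in> ?S" "u \<noteq> \<zero>\<^bsub>F\<^esub>"
    then show "\<iota> u \<noteq> \<zero>\<^bsub>C\<^esub>"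
      using inj_onD[OF \<iota>_inj, of u "\<zero>\<^bsub>F\<^esub>"] by (auto simp: frobenius_fixed_def)
    have "\<iota> x \<in> frobenius_fixed C (p ^ 1)" if "x \<in> ?S" for x
      using that \<iota>.hom_nat_pow[of x p] by (auto simp: frobenius_fixed_def)
    then show "\<iota> ` ?S \<subseteq> M"
      unfolding M_def frobenius_periodic_def by blast
    show "\<iota> \<in> ring_hom (F\<lparr>carrier := ?S\<rparr>) C"
      using \<iota> by (auto simp: ring_hom_def frobenius_fixed_def)
  qed
  then obtain T where T: "subring T F" "A \<subseteq> T" "separated_by_homs F C M T"
    using exists_separated_subring[OF F C.field_axioms M rc S _ A] by blast
  \<comment> \<open>The element kept nonzero is now simply one.\<close>
  obtain \<phi> where \<phi>: "\<phi> \<in> ring_hom (F\<lparr>carrier := T\<rparr>) C" "\<phi> ` T \<subseteq> M"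
    using T(3) subringE(3)[OF T(1)] F.one_not_zero unfolding separated_by_homs_def by blast
  interpret \<phi>: ring_hom_ring "F\<lparr>carrier := T\<rparr>" C \<phi>
    using F.subring_is_ring[OF T(1)] C.ring_axioms \<phi>(1) by (rule ring_hom_ringI2)
  have "finite (\<phi> ` A)" "\<phi> ` A \<subseteq> frobenius_periodic C p"
    using A(1) T(2) \<phi>(2) by (auto simp: M_def)
  then obtain m where m: "0 < m" "\<phi> ` A \<subseteq> frobenius_fixed C (p ^ m)"
    by (rule C.finite_subset_frobenius_periodic)
  let ?E = "frobenius_fixed C (p ^ m)"
  have E: "subfield ?E C"
    using p(1) pC by (rule C.subfield_frobenius_fixed)
  note E' = subringE[OF subfieldE(1)[OF E]]
  interpret E: field "C\<lparr>carrier := ?E\<rparr>"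
    using E C.subfield_iff(2) by blast
  have "1 < p ^ m"
    using prime_gt_1_nat[OF p(1)] m(1) by (rule one_less_power)
  then have finE: "finite ?E"
    by (rule C.finite_frobenius_fixed)
  \<comment> \<open>The elements of the closure have a type built from that of \<open>F\<close>;
    numbering the finitely many elements of \<open>?E\<close> moves the field to the natural
    numbers.\<close>
  then obtain f :: "(('f list \<times> nat) multiset \<Rightarrow> 'f) \<Rightarrow> nat" where f: "inj_on f ?E"
    using finite_imp_inj_to_nat_seg by meson
  define E\<^sub>0 where "E\<^sub>0 = image_ring f (C\<lparr>carrier := ?E\<rparr>)"
  have field_E\<^sub>0: "field E\<^sub>0"
    unfolding E\<^sub>0_def using f by (intro E.inj_imp_image_ring_is_field) simp
  interpret E\<^sub>0: field E\<^sub>0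
    by (rule field_E\<^sub>0)
  have f_hom: "f \<in> ring_hom (C\<lparr>carrier := ?E\<rparr>) E\<^sub>0"
    using inj_imp_image_ring_iso[of f "C\<lparr>carrier := ?E\<rparr>"] f by (simp add: E\<^sub>0_def ring_iso_def)
  \<comment> \<open>Only the images of \<open>A\<close> are known to lie in \<open>?E\<close>; other
    elements of \<open>T\<close> may have larger periods. The preimage of \<open>?E\<close> is a
    subring on which \<open>\<phi>\<close> has values in the finite field, and it still contains
    \<open>A\<close>.\<close>
  define T' where "T' = {t \<in> T. \<phi> t \<in> ?E}"
  note T_sub = subringE[OF T(1)]
  have T': "subring T' F"
  proof (rule F.subringI)
    fix h
    assume h: "h \<in> T'"
    \<comment> \<open>The additive inverse is defined relative to the carrier, so the inverses in
      \<open>F\<close> and in its restriction to \<open>T\<close> have to be identified before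
      \<open>\<phi>\<close> can be applied.\<close>
    have "\<ominus>\<^bsub>F\<lparr>carrier := T\<rparr>\<^esub> h = \<ominus>\<^bsub>F\<^esub> h"
      using h T_sub(1,5) \<phi>.R.l_neg[of h] \<phi>.R.a_inv_closed[of h]
      by (intro F.minus_equality[symmetric]) (auto simp: T'_def)
    then show "\<ominus>\<^bsub>F\<^esub> h \<in> T'"
      using h T_sub(5) E'(5) \<phi>.hom_a_inv[of h] by (auto simp: T'_def)
  next
    fix g h
    assume "g \<in> T'" "h \<in> T'"
    then show "g \<otimes>\<^bsub>F\<^esub> h \<in> T'" "g \<oplus>\<^bsub>F\<^esub> h \<in> T'"
      using T_sub(6,7)[of g h] E'(6,7)[of "\<phi> g" "\<phi> h"] \<phi>.hom_mult[of g h] \<phi>.hom_add[of g h]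
      by (auto simp: T'_def)
  qed (use T_sub(1,3) E'(3) \<phi>.hom_one in \<open>auto simp: T'_def\<close>)
  have "\<phi> \<in> ring_hom (F\<lparr>carrier := T'\<rparr>) (C\<lparr>carrier := ?E\<rparr>)"
    using \<phi>(1) by (auto simp: ring_hom_def T'_def)
  then have hom: "f \<circ> \<phi> \<in> ring_hom (F\<lparr>carrier := T'\<rparr>) E\<^sub>0"
    using f_hom by (rule ring_hom_trans)
  have "[p] \<cdot>\<^bsub>F\<lparr>carrier := T'\<rparr>\<^esub> \<one>\<^bsub>F\<^esub> = [p] \<cdot>\<^bsub>F\<^esub> \<one>\<^bsub>F\<^esub>"
    by (simp add: add_pow_def nat_pow_def)
  then have "[p] \<cdot>\<^bsub>E\<^sub>0\<^esub> \<one>\<^bsub>E\<^sub>0\<^esub> = \<zero>\<^bsub>E\<^sub>0\<^esub>"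
    using ring_hom_add_pow[OF F.subring_is_ring[OF T'] E\<^sub>0.ring_axioms hom, of "\<one>\<^bsub>F\<^esub>" p] subringE(3)[OF T']
      p(2) ring_hom_one[OF hom] ring_hom_zero[OF hom F.subring_is_ring[OF T'] E\<^sub>0.ring_axioms] by simp
  then have "ring_characteristic E\<^sub>0 = p"
    using p(1) by (intro E\<^sub>0.ring_characteristic_eq_prime) simp_all
  moreover have "finite (carrier E\<^sub>0)"
    using finE by (simp add: E\<^sub>0_def image_ring_carrier)
  moreover have "A \<subseteq> T'"
    using T(2) m(2) by (auto simp: T'_def)
  ultimately show ?thesis
    using that[OF T' _ field_E\<^sub>0 _ _ hom] by blast
qed

theorem corollary2:
  fixes p :: nat
    and G :: "('a, 'm) monoid_scheme"
    and H :: "('b, 'n) monoid_scheme"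
    and F :: "('f, 'l) ring_scheme"
  assumes "Factorial_Ring.prime p"
    and "finite_p_group p G"
    and "finite_p_group p H"
    and "field F"
    and "ring_characteristic F = p"
    and "algebra_isomorphic F (group_algebra F G) (group_algebra F H)"
  shows "\<exists>F\<^sub>0 :: nat ring.
           field F\<^sub>0 \<and> finite (carrier F\<^sub>0) \<and> ring_characteristic F\<^sub>0 = p \<and>
           algebra_isomorphic F\<^sub>0 (group_algebra F\<^sub>0 G) (group_algebra F\<^sub>0 H)"
proof -
  have G: "group G" "finite (carrier G)" and H: "group H" "finite (carrier H)"
    using assms(2,3) by (auto simp: finite_p_group_def)
  \<comment> \<open>Stated for an arbitrary field because it is applied both to \<open>F\<close> and
    to the finite field \<open>E\<close>, whose element types differ.\<close>
  have pair: "group_algebra_pair K G H" if "field K" for K :: "('k, 'r) ring_scheme"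
    using that G H by (intro group_algebra_pair.intro finite_group_algebra.intro
        finite_group_algebra_axioms.intro)
  have char: "[p] \<cdot>\<^bsub>F\<^esub> \<one>\<^bsub>F\<^esub> = \<zero>\<^bsub>F\<^esub>"
    using assms(5) prime_gt_0_nat[OF assms(1)] by (rule ring_characteristic_add_pow)
  obtain A B where AB: "group_algebra_matrices F G H A B"
    using assms(6) group_algebra_pair.matrices_of_iso[OF pair[OF assms(4)]]
    unfolding algebra_isomorphic_def by blast
  define Z where "Z = (\<lambda>(g, y). A g y) ` (carrier G \<times> carrier H) \<union> (\<lambda>(g, y). B y g) ` (carrier G \<times> carrier H)"
  have "finite Z" "Z \<subseteq> carrier F"
    using G H AB by (auto simp: Z_def group_algebra_matrices_def)
  then obtain T and E :: "nat ring" and \<phi> where T: "subring T F" "Z \<subseteq> T"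
    and E: "field E" "finite (carrier E)" "ring_characteristic E = p"
    and \<phi>: "\<phi> \<in> ring_hom (F\<lparr>carrier := T\<rparr>) E"
    using exists_hom_to_finite_field[OF assms(4,1) char] by metis
  have "group_algebra_matrices E G H (\<lambda>g y. \<phi> (A g y)) (\<lambda>y g. \<phi> (B y g))"
    using AB field.is_ring[OF assms(4)] field.is_ring[OF E(1)] G(1) H(1) T(1) \<phi>
  proof (rule group_algebra_matrices_hom)
    fix g y
    assume "g \<in> carrier G" "y \<in> carrier H"
    then have "A g y \<in> Z" "B y g \<in> Z"
      unfolding Z_def by force+
    then show "A g y \<in> T" "B y g \<in> T"
      using T(2) by auto
  qed
  then have "algebra_isomorphic E (group_algebra E G) (group_algebra E H)"
    by (rule group_algebra_pair.iso_of_matrices[OF pair[OF E(1)]])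
  then show ?thesis
    using E by blast
qed

end
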